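(* Consider finite MDPs $(\mathcal S,\mathcal A,P,R,\gamma)$ with $R:\mathcal S\times\mathcal A\to[0,L]$, and suppose $|\mathrm{supp}\,P(\cdot\mid s,a)|\le m$ for every $(s,a)$, with $m$ independent of $|\mathcal S|$. Suppose the approximate-nearest-neighbor (ANN) index answers a $k'$-neighbor query over $|\mathcal S|$ points in amortized time $q(|\mathcal S|)$ after an $\widetilde O(|\mathcal S|)$ build. Let $c_m=O(m^3\log m)$ denote the cost of one exact covered backup (independent of $|\mathcal S|$). Then: (1) The single-build restricted iteration spends $O\big(|\mathcal S|(\mathrm{poly}(k)+q(|\mathcal S|))\big)$ time once, on the embedding into $\mathbb R^k$, the index build and the queries, and $O(|\mathcal S|\,k'\,c_m)$ time per sweep thereafter. (2) $K=O\big(\log(\Delta_0/\epsilon)/(1-\gamma)\big)$ sweeps reach covered-set accuracy $\epsilon$ beyond the coverage floor, i.e. $\max_{p\in\mathcal C}|\hat d(p)-d(p)|\le \gamma\max_{p\notin\mathcal C}|d(p)-d_0(p)|+\epsilon$, where $\Delta_0=\|d_0-d\|_\infty$. The total time is therefore $$O\Big(|\mathcal S|\big(\mathrm{poly}(k)+q(|\mathcal S|)\big)+\tfrac{|\mathcal S|\,k'\,c_m}{1-\gamma}\log\tfrac{\Delta_0}{\epsilon}\Big).$$ This is $\widetilde O\big(|\mathcal S|^{1+\rho_{\mathrm{LSH}}}+|\mathcal S|/(1-\gamma)\big)$ when $q(|\mathcal S|)=O(|\mathcal S|^{\rho_{\mathrm{LSH}}})$ with $\rho_{\mathrm{LSH}}<1$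 (locality-sensitive hashing), and $\widetilde O\big(|\mathcal S|/(1-\gamma)\big)$ when $q$ is polylogarithmic. In either case it is sub-quadratic in $|\mathcal S|$, whereas one sweep of the exact all-pairs iteration $f\mapsto Tf$ costs $\Theta(|\mathcal S|^2c_m)$. (3) The re-seeded two-arm pipeline with $R$ re-seed rounds remains sub-quadratic in $|\mathcal S|$ for any $R=o\big(|\mathcal S|/q(|\mathcal S|)\big)$. Driving the certificate width (upper iterate minus lower iterate) to zero on all pairs forces $R=\Omega(|\mathcal S|/k')$, i.e. quadratic total work.
   Context: Setting. $(\mathcal S,\mathcal A,P,R,\gamma)$ is a finite MDP with rewards in $[0,L]$ and $\gamma\in[0,1)$. Functions on pairs are real, symmetric, and zero on the diagonal; $\|f\|_\infty=\max_{s,s'}|f(s,s')|$. For a ground cost $f$, $W_1^f(\mu,\nu)=\min_\pi\sum_{x,y}f(x,y)\pi(x,y)$ over couplings $\pi$ of $\mu,\nu$. For $s\ne s'$, $(Tf)(s,s')=\max_{a}\big[|R(s,a)-R(s',a)|+\gamma W_1^f(P(\cdot|s,a),P(\cdot|s',a))\big]$. $T$ is a $\gamma$-contraction in sup-norm, and the bisimulation metric $d$ is its unique fixed point. $D_\gamma:=L/(1-\gamma)$ and $d_R(s,s'):=\max_a|R(s,a)-R(s',a)|$. Cost conventions. $|\mathcal A|$ is treated as fixed. The transport problem of a backup is solved on the union of the two supports. $\widetilde O$ hides polylogarithmic factors and, in the simplified bounds, the fixed quantities $k,k',c_m$. In (3), $k,k',m$, the number $E$ of sweeps per round, and the exploration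 count $u$ are fixed. Single-build restricted iteration. Input: embedding dimension $k$, neighbor budget $k'$, number of sweeps $K$, and initialization $d_0$ (either $d_0\le d$ with $d_0\in\{0,d_R\}$, or the upper freeze $d_0\equiv D_\gamma$ off the diagonal); entries of $d_0$ are not stored but computed on demand in $O(|\mathcal A|)$ time. Step 1: compute a landmark multidimensional-scaling embedding $\phi:\mathcal S\to\mathbb R^k$ of $d_0$ using $\mathrm{poly}(k)$ landmarks (reads only the landmark columns of $d_0$; eigen-step on the landmarks plus an out-of-sample projection for each state). Step 2: build an ANN index over $\{\phi(s)\}$ and, for each $s$, query it to get a list $N(s)$ of $k'$ states; set $\mathcal C=\{\{s,s'\}:s'\in N(s)\text{ or }s\in N(s')\}$ (the covered pairs). Step 3: starting from $\hat d=d_0$, perform $K$ synchronous (Jacobi) sweeps, each replacing $\hat d(p)$ by $(T\hat d)(p)$ for every $p\in\mathcal C$ (exact backup, with the right side evaluated at the previous sweep) and leaving $\hat d(p)=d_0(p)$ for $p\notin\mathcal C$. Output $\hat d$ and $\mathcal C$. Re-seeded two-arm pipeline. Maintain a lower iterate started at $d_R$, an upper iterate started at $D_\gamma$ off the diagonal, and a cumulative covered set $\mathcal C$, initially empty. Each of $R$ rounds: re-embed the current lower iterate by landmark MDS; build a fresh ANN index and query every state for $k'$ neighbors, adding the retrieved pairs to $\mathcal C$; for each state also add $u\ge1$ pairs with uniformly random partners; then run $E$ sweeps of the exact restricted backup for both iterates on $\mathcal C$ (uncovered entries keep their initial values).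
   Formalization: In (3), sub-quadratic total time is proved for R=o(|S|/q) only if also R=o(√|S|), since sweeps run on the cumulative covered set; the R=Ω(|S|/k') claim takes L>0; the index build is charged to the amortized q; log(Δ0/ε) is read as at least 1. *)

theory Defs
  imports "HOL-Probability.Probability" "HOL-Library.Landau_Symbols"
begin

section \<open>Finite MDPs and the bisimulation metric\<close>

text \<open>
  The state set is \<open>{..<state_count M}\<close> and the action set is \<open>{..<action_count M}\<close>, so that
  asymptotic statements can range over MDPs of every size.
\<close>

record mdp =
  state_count :: nat
  action_count :: nat
  kern :: "nat \<Rightarrow> nat \<Rightarrow> nat pmf"
  rew :: "nat \<Rightarrow> nat \<Rightarrow> real"
  rmax :: real
  disc :: real

definition mdp_wf :: "mdp \<Rightarrow> bool" where
  "mdp_wf M \<longleftrightarrow> 0 < state_count M \<and> 0 < action_count M \<and> 0 \<le> disc M \<and> disc M < 1 \<and>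
     (\<forall>s<state_count M. \<forall>a<action_count M.
        set_pmf (kern M s a) \<subseteq> {..<state_count M} \<and> 0 \<le> rew M s a \<and> rew M s a \<le> rmax M)"

definition mdps :: "nat \<Rightarrow> nat \<Rightarrow> mdp set" where
  "mdps A m = {M. mdp_wf M \<and> action_count M = A \<and>
     (\<forall>s<state_count M. \<forall>a<A. card (set_pmf (kern M s a)) \<le> m)}"

type_synonym pair_fun = "nat \<Rightarrow> nat \<Rightarrow> real"

text \<open>The infimum is attained: the couplings of two finitely supported measures form a compact set.\<close>

definition wasserstein :: "pair_fun \<Rightarrow> nat pmf \<Rightarrow> nat pmf \<Rightarrow> real" where
  "wasserstein f \<mu> \<nu> =
     (INF \<pi>\<in>{\<pi>. map_pmf fst \<pi> = \<mu> \<and> map_pmf snd \<pi> = \<nu>}.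
        measure_pmf.expectation \<pi> (\<lambda>(x, y). f x y))"

definition is_pair_fun :: "mdp \<Rightarrow> pair_fun \<Rightarrow> bool" where
  "is_pair_fun M f \<longleftrightarrow> (\<forall>s s'. f s s' = f s' s) \<and> (\<forall>s. f s s = 0) \<and>
     (\<forall>s s'. \<not> (s < state_count M \<and> s' < state_count M) \<longrightarrow> f s s' = 0)"

definition bisim_op :: "mdp \<Rightarrow> pair_fun \<Rightarrow> pair_fun" where
  "bisim_op M f s s' =
     (if s < state_count M \<and> s' < state_count M \<and> s \<noteq> s' then
        Max ((\<lambda>a. \<bar>rew M s a - rew M s' a\<bar> + disc M * wasserstein f (kern M s a) (kern M s' a))
               ` {..<action_count M})
      else 0)"

definition bisim_metric :: "mdp \<Rightarrow> pair_fun" where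
  "bisim_metric M = (THE f. is_pair_fun M f \<and> bisim_op M f = f)"

definition sup_norm :: "mdp \<Rightarrow> pair_fun \<Rightarrow> real" where
  "sup_norm M f = Max ((\<lambda>(s, s'). \<bar>f s s'\<bar>) ` ({..<state_count M} \<times> {..<state_count M}))"

definition D_max :: "mdp \<Rightarrow> real" where
  "D_max M = rmax M / (1 - disc M)"

definition reward_dist :: "mdp \<Rightarrow> pair_fun" where
  "reward_dist M s s' = Max ((\<lambda>a. \<bar>rew M s a - rew M s' a\<bar>) ` {..<action_count M})"

datatype init = Zero | Reward | Freeze

definition init_fun :: "mdp \<Rightarrow> init \<Rightarrow> pair_fun" where
  "init_fun M ini s s' =
     (case ini of
        Zero \<Rightarrow> 0
      | Reward \<Rightarrow> reward_dist M s s'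
      | Freeze \<Rightarrow> (if s = s' then 0 else D_max M))"

definition init_gap :: "mdp \<Rightarrow> init \<Rightarrow> real" where
  "init_gap M ini = sup_norm M (\<lambda>s s'. init_fun M ini s s' - bisim_metric M s s')"


section \<open>Timed computations\<close>

text \<open>
  A timed computation is its result together with the number of elementary steps of a real RAM.
  Arithmetic, table look-ups and insertions cost one step.
\<close>

type_synonym 'a timed = "'a \<times> real"

definition bind_timed :: "'a timed \<Rightarrow> ('a \<Rightarrow> 'b timed) \<Rightarrow> 'b timed" (infixl "\<then>" 55) where
  "x \<then> f = (fst (f (fst x)), snd x + snd (f (fst x)))"

text \<open>
  The external routines.  \<open>ot_time N\<close> is the time of the exact transport solver on \<open>N\<close> points,
  \<open>eig_time l\<close> the time of the eigen-step on \<open>l\<close> landmarks, \<open>lm_count k\<close> the number of landmarks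
  for an embedding into dimension \<open>k\<close>, \<open>ann_build_time k n\<close> the time to index \<open>n\<close> points of
  dimension \<open>k\<close>.  \<open>ann_query z xs k' s\<close> is the answer to a \<open>k'\<close>-neighbor query for the \<open>s\<close>-th point
  of \<open>xs\<close>, with the time of that query; the seed \<open>z\<close> stands for the internal randomness of an index.
\<close>

record routines =
  ot_time :: "nat \<Rightarrow> real"
  eig_time :: "nat \<Rightarrow> real"
  lm_count :: "nat \<Rightarrow> nat"
  ann_build_time :: "nat \<Rightarrow> nat \<Rightarrow> real"
  ann_query :: "nat \<Rightarrow> real list list \<Rightarrow> nat \<Rightarrow> nat \<Rightarrow> nat list timed"

definition routine_costs :: "routines \<Rightarrow> bool" where
  "routine_costs H \<longleftrightarrow>
     mono (ot_time H) \<and> (\<forall>N. 0 \<le> ot_time H N) \<and>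
     ot_time H \<in> O(\<lambda>N. real N ^ 3 * ln (real N)) \<and>
     (\<forall>l. 0 \<le> eig_time H l) \<and> (\<exists>c e. \<forall>l. eig_time H l \<le> c * (1 + real l) ^ e) \<and>
     (\<exists>c e. \<forall>k\<ge>1. real (lm_count H k) \<le> c * real k ^ e)"

text \<open>
  \<open>q k k' n\<close> is the amortized time of a \<open>k'\<close>-neighbor query over \<open>n\<close> points of dimension \<open>k\<close>.
  The amortization is over the life of the index, i.e. the build and one query per point.  An
  answer may or may not contain the queried point itself, and writing it down is part of the query
  time.  Nothing is assumed on the quality of the answers.
\<close>

definition ann_index :: "routines \<Rightarrow> (nat \<Rightarrow> nat \<Rightarrow> nat \<Rightarrow> real) \<Rightarrow> bool" where
  "ann_index H q \<longleftrightarrow>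
     (\<forall>k n. 0 \<le> ann_build_time H k n) \<and>
     (\<forall>k\<ge>1. \<exists>j. ann_build_time H k \<in> O(\<lambda>n. real n * ln (real n) ^ j)) \<and>
     (\<forall>z k k' xs. 1 \<le> k \<and> 1 \<le> k' \<and> xs \<noteq> [] \<and> (\<forall>x\<in>set xs. length x = k) \<longrightarrow>
        (\<forall>s<length xs. let N = fst (ann_query H z xs k' s) in
           distinct N \<and> set N \<subseteq> {..<length xs} \<and>
           min k' (length xs - 1) \<le> length N \<and> length N \<le> k' \<and>
           real (length N) \<le> snd (ann_query H z xs k' s)) \<and>
        ann_build_time H k (length xs) + (\<Sum>s<length xs. snd (ann_query H z xs k' s))
          \<le> real (length xs) * q k k' (length xs))"


section \<open>Landmark multidimensional scaling\<close>

definition col_mean :: "nat list \<Rightarrow> pair_fun \<Rightarrow> nat \<Rightarrow> real" where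
  "col_mean lm f i = (\<Sum>j<length lm. (f (lm ! i) (lm ! j))\<^sup>2) / real (length lm)"

definition gram :: "nat list \<Rightarrow> pair_fun \<Rightarrow> nat \<Rightarrow> nat \<Rightarrow> real" where
  "gram lm f i j = - (1/2) * ((f (lm ! i) (lm ! j))\<^sup>2 - col_mean lm f i - col_mean lm f j
     + (\<Sum>t<length lm. col_mean lm f t) / real (length lm))"

definition eigenpair :: "nat \<Rightarrow> (nat \<Rightarrow> nat \<Rightarrow> real) \<Rightarrow> real \<Rightarrow> (nat \<Rightarrow> real) \<Rightarrow> bool" where
  "eigenpair l B r v \<longleftrightarrow> (\<exists>i<l. v i \<noteq> 0) \<and> (\<forall>i<l. (\<Sum>j<l. B i j * v j) = r * v i)"

definition top_eigenpairs ::
    "nat \<Rightarrow> nat \<Rightarrow> (nat \<Rightarrow> nat \<Rightarrow> real) \<Rightarrow> (real \<times> (nat \<Rightarrow> real)) list \<Rightarrow> bool" where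
  "top_eigenpairs l k B es \<longleftrightarrow>
     length es = min k l \<and>
     (\<forall>(r, v)\<in>set es. eigenpair l B r v) \<and>
     (\<forall>a<length es. \<forall>b<length es.
        (\<Sum>i<l. snd (es ! a) i * snd (es ! b) i) = (if a = b then 1 else 0)) \<and>
     sorted_wrt (\<ge>) (map fst es) \<and>
     (\<forall>r w. eigenpair l B r w \<and> (\<forall>(r', v)\<in>set es. (\<Sum>i<l. v i * w i) = 0) \<longrightarrow>
        (\<forall>(r', v)\<in>set es. r \<le> r'))"

text \<open>
  Coordinates of a state by distance-based triangulation from the landmarks (de Silva and
  Tenenbaum).  Directions with a nonpositive eigenvalue are collapsed to zero.
\<close>

definition landmark_mds :: "nat \<Rightarrow> nat list \<Rightarrow> pair_fun \<Rightarrow> nat \<Rightarrow> real list" where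
  "landmark_mds k lm f s =
     (let es = (SOME es. top_eigenpairs (length lm) k (gram lm f) es) in
      map (\<lambda>a. if a < length es \<and> 0 < fst (es ! a)
               then - (1/2) / sqrt (fst (es ! a)) *
                    (\<Sum>i<length lm. snd (es ! a) i * ((f s (lm ! i))\<^sup>2 - col_mean lm f i))
               else 0)
          [0..<k])"

definition landmarks :: "routines \<Rightarrow> mdp \<Rightarrow> nat \<Rightarrow> nat list \<Rightarrow> bool" where
  "landmarks H M k lm \<longleftrightarrow> distinct lm \<and> set lm \<subseteq> {..<state_count M} \<and>
     length lm = min (lm_count H k) (state_count M)"


section \<open>Single-build restricted iteration\<close>

text \<open>
  An iterate is a table of the entries that have been backed up, keyed by unordered pairs.  All
  other entries are those of the initialization and are recomputed at each access.
\<close>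

type_synonym tbl = "nat set \<Rightarrow> real option"

definition read_iter :: "mdp \<Rightarrow> init \<Rightarrow> tbl \<Rightarrow> nat \<Rightarrow> nat \<Rightarrow> real timed" where
  "read_iter M ini t x y =
     (if x = y then (0, 1)
      else case t {x, y} of
             Some v \<Rightarrow> (v, 1)
           | None \<Rightarrow> (init_fun M ini x y, 1 + real (action_count M)))"

definition iter_fun :: "mdp \<Rightarrow> init \<Rightarrow> tbl \<Rightarrow> pair_fun" where
  "iter_fun M ini t x y = fst (read_iter M ini t x y)"

definition transport ::
    "routines \<Rightarrow> (nat \<Rightarrow> nat \<Rightarrow> real timed) \<Rightarrow> nat pmf \<Rightarrow> nat pmf \<Rightarrow> real timed" where
  "transport H rd \<mu> \<nu> =
     (let U = set_pmf \<mu> \<union> set_pmf \<nu> in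
      (wasserstein (\<lambda>x y. fst (rd x y)) \<mu> \<nu>,
       (\<Sum>x\<in>U. \<Sum>y\<in>U. snd (rd x y)) + ot_time H (card U)))"

definition backup ::
    "routines \<Rightarrow> mdp \<Rightarrow> (nat \<Rightarrow> nat \<Rightarrow> real timed) \<Rightarrow> nat \<Rightarrow> nat \<Rightarrow> real timed" where
  "backup H M rd s s' =
     (Max ((\<lambda>a. \<bar>rew M s a - rew M s' a\<bar> + disc M * fst (transport H rd (kern M s a) (kern M s' a)))
             ` {..<action_count M}),
      1 + (\<Sum>a<action_count M. 1 + snd (transport H rd (kern M s a) (kern M s' a))))"

text \<open>
  The cost \<open>c\<^sub>m\<close> of one covered backup: per action, at most \<open>(2 m)\<^sup>2\<close> ground-cost entries are read,
  each in at most \<open>1 + A\<close> steps, and one transport problem on at most \<open>2 m\<close> points is solved.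
\<close>

definition backup_cost :: "routines \<Rightarrow> nat \<Rightarrow> nat \<Rightarrow> real" where
  "backup_cost H A m =
     1 + real A * (1 + (2 * real m)\<^sup>2 * (1 + real A) + ot_time H (2 * m))"

definition embed ::
    "routines \<Rightarrow> mdp \<Rightarrow> nat \<Rightarrow> nat list \<Rightarrow> (nat \<Rightarrow> nat \<Rightarrow> real timed) \<Rightarrow> real list list timed" where
  "embed H M k lm rd =
     (map (landmark_mds k lm (\<lambda>x y. fst (rd x y))) [0..<state_count M],
      (\<Sum>s<state_count M. \<Sum>l\<leftarrow>lm. snd (rd s l))
        + real (length lm) ^ 2 + eig_time H (length lm)
        + real (state_count M) * (real k * (1 + real (length lm))))"

text \<open>Diagonal entries are never stored, so a state is not paired with itself.\<close>

definition retrieve ::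
    "routines \<Rightarrow> mdp \<Rightarrow> nat \<Rightarrow> nat \<Rightarrow> nat \<Rightarrow> real list list \<Rightarrow> nat set set timed" where
  "retrieve H M z k k' xs =
     ({{s, s'} |s s'. s < state_count M \<and> s' \<in> set (fst (ann_query H z xs k' s)) \<and> s' \<noteq> s},
      ann_build_time H k (state_count M)
        + (\<Sum>s<state_count M. snd (ann_query H z xs k' s)
             + real (length (fst (ann_query H z xs k' s)))))"

definition setup_cover ::
    "routines \<Rightarrow> mdp \<Rightarrow> init \<Rightarrow> nat \<Rightarrow> nat \<Rightarrow> nat \<Rightarrow> nat list \<Rightarrow> nat set set timed" where
  "setup_cover H M ini z k k' lm =
     embed H M k lm (read_iter M ini Map.empty) \<then> retrieve H M z k k'"

definition sweep :: "routines \<Rightarrow> mdp \<Rightarrow> init \<Rightarrow> nat set set \<Rightarrow> tbl \<Rightarrow> tbl timed" where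
  "sweep H M ini C t =
     (let b = (\<lambda>p. backup H M (read_iter M ini t) (Min p) (Max p)) in
      (\<lambda>p. if p \<in> C then Some (fst (b p)) else t p, \<Sum>p\<in>C. snd (b p)))"

primrec sweeps :: "routines \<Rightarrow> mdp \<Rightarrow> init \<Rightarrow> nat set set \<Rightarrow> nat \<Rightarrow> tbl \<Rightarrow> tbl timed" where
  "sweeps H M ini C 0 t = (t, 0)"
| "sweeps H M ini C (Suc K) t = sweeps H M ini C K t \<then> sweep H M ini C"

definition single_build ::
    "routines \<Rightarrow> mdp \<Rightarrow> init \<Rightarrow> nat \<Rightarrow> nat \<Rightarrow> nat \<Rightarrow> nat list \<Rightarrow> nat \<Rightarrow> (pair_fun \<times> nat set set) timed"
  where
  "single_build H M ini z k k' lm K =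
     setup_cover H M ini z k k' lm \<then> (\<lambda>C.
     sweeps H M ini C K Map.empty \<then> (\<lambda>t.
     ((iter_fun M ini t, C), 0)))"

text \<open>Maxima of absolute errors; the maximum over no pairs is \<open>0\<close>.\<close>

definition covered_error :: "mdp \<Rightarrow> nat set set \<Rightarrow> pair_fun \<Rightarrow> real" where
  "covered_error M C f =
     Max (insert 0 {\<bar>f s s' - bisim_metric M s s'\<bar> |s s'.
       s < state_count M \<and> s' < state_count M \<and> {s, s'} \<in> C})"

definition coverage_floor :: "mdp \<Rightarrow> init \<Rightarrow> nat set set \<Rightarrow> real" where
  "coverage_floor M ini C =
     Max (insert 0 {\<bar>bisim_metric M s s' - init_fun M ini s s'\<bar> |s s'.
       s < state_count M \<and> s' < state_count M \<and> {s, s'} \<notin> C})"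

text \<open>\<open>sweep_count\<close> is \<open>0\<close> when the initialization is already \<open>\<epsilon>\<close>-accurate.\<close>

definition sweep_count :: "mdp \<Rightarrow> init \<Rightarrow> real \<Rightarrow> nat" where
  "sweep_count M ini \<epsilon> = nat \<lceil>ln (init_gap M ini / \<epsilon>) / (1 - disc M)\<rceil>"

text \<open>
  The logarithm \<open>ln (\<Delta>\<^sub>0 / \<epsilon>)\<close> of the running time bounds, bounded away from zero as is implicit in the
  O-notation.
\<close>

definition log_gap :: "mdp \<Rightarrow> init \<Rightarrow> real \<Rightarrow> real" where
  "log_gap M ini \<epsilon> = max 1 (ln (init_gap M ini / \<epsilon>))"

text \<open>One sweep of \<open>f \<mapsto> T f\<close> over all pairs, with \<open>f\<close> stored in an array.\<close>

definition full_sweep :: "routines \<Rightarrow> mdp \<Rightarrow> pair_fun \<Rightarrow> pair_fun timed" where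
  "full_sweep H M f =
     (let b = backup H M (\<lambda>x y. (f x y, 1)) in
      (\<lambda>s s'. if s < state_count M \<and> s' < state_count M \<and> s \<noteq> s' then fst (b s s') else 0,
       \<Sum>(s, s')\<in>{(s, s'). s < s' \<and> s' < state_count M}. snd (b s s')))"


section \<open>Re-seeded two-arm pipeline\<close>

text \<open>Lower iterate, upper iterate, cumulative covered set.\<close>

type_synonym arms = "tbl \<times> tbl \<times> nat set set"

text \<open>\<open>w (r, s, i)\<close> is the \<open>i\<close>-th exploration partner of state \<open>s\<close> in round \<open>r\<close>: independent and
  uniform among the other states, hence meaningful from two states on.\<close>

definition partners :: "mdp \<Rightarrow> nat \<Rightarrow> nat \<Rightarrow> (nat \<times> nat \<times> nat \<Rightarrow> nat) pmf" where
  "partners M u R =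
     pmf_of_set (PiE ({..<R} \<times> {..<state_count M} \<times> {..<u}) (\<lambda>(r, s, i). {..<state_count M} - {s}))"

definition reseed ::
    "routines \<Rightarrow> mdp \<Rightarrow> nat \<Rightarrow> nat \<Rightarrow> nat \<Rightarrow> (nat \<Rightarrow> nat list) \<Rightarrow> (nat \<times> nat \<times> nat \<Rightarrow> nat) \<Rightarrow>
     nat \<Rightarrow> arms \<Rightarrow> nat set set timed" where
  "reseed H M k k' u lms w r st =
     embed H M k (lms r) (read_iter M Reward (fst st)) \<then> (\<lambda>xs.
     retrieve H M r k k' xs \<then> (\<lambda>D.
     (D \<union> {{s, w (r, s, i)} |s i. s < state_count M \<and> i < u}, real (state_count M) * real u)))"

definition pipeline_round ::
    "routines \<Rightarrow> mdp \<Rightarrow> nat \<Rightarrow> nat \<Rightarrow> nat \<Rightarrow> nat \<Rightarrow> (nat \<Rightarrow> nat list) \<Rightarrow> (nat \<times> nat \<times> nat \<Rightarrow> nat) \<Rightarrow>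
     nat \<Rightarrow> arms \<Rightarrow> arms timed" where
  "pipeline_round H M k k' u E lms w r st =
     reseed H M k k' u lms w r st \<then> (\<lambda>D.
     sweeps H M Reward (snd (snd st) \<union> D) E (fst st) \<then> (\<lambda>lo.
     sweeps H M Freeze (snd (snd st) \<union> D) E (fst (snd st)) \<then> (\<lambda>hi.
     ((lo, hi, snd (snd st) \<union> D), 0))))"

primrec pipeline ::
    "routines \<Rightarrow> mdp \<Rightarrow> nat \<Rightarrow> nat \<Rightarrow> nat \<Rightarrow> nat \<Rightarrow> (nat \<Rightarrow> nat list) \<Rightarrow> (nat \<times> nat \<times> nat \<Rightarrow> nat) \<Rightarrow>
     nat \<Rightarrow> arms timed" where
  "pipeline H M k k' u E lms w 0 = ((Map.empty, Map.empty, {}), 0)"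
| "pipeline H M k k' u E lms w (Suc r) =
     pipeline H M k k' u E lms w r \<then> pipeline_round H M k k' u E lms w r"

definition cert_width :: "mdp \<Rightarrow> arms \<Rightarrow> pair_fun" where
  "cert_width M st s s' = iter_fun M Freeze (fst (snd st)) s s' - iter_fun M Reward (fst st) s s'"

end

(*
  A change of the ground cost by at most d moves the Wasserstein distance by at most d, so the backup
  contracts and the error of the restricted iteration on the covered set obeys
  e(K+1) <= gamma * max (e(K)) floor.  The time bounds count the backups of the at most n * k' covered pairs.

  For the certificate: an uncovered pair keeps the width D - d_R, which is positive as soon as d_R < L.
  Sorting the states by the set of actions with reward at least L/2 gives 2^A classes inside which
  d_R < L, so all pairs inside the classes have to be covered, and by Cauchy-Schwarz these are
  quadratically many.  A round covers at most n * (k' + u) new pairs, and every covered pair was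
  written down once.
*)
theory Submission
  imports Defs "HOL-Real_Asymp.Real_Asymp"
begin

section \<open>Contraction and accuracy\<close>

text \<open>In the main time bounds the constants are chosen before \<open>m\<close>,
  \<open>k\<close>, \<open>k'\<close> and the MDP, so they may depend only on the routines and the
  number of actions. Explicit inequalities are therefore carried along, and asymptotics enter late.
  Sweeps of the pipeline act on the cumulative cover, which can reach R n (k' + u) pairs, so the
  whole run carries a term quadratic in R. Hence R = o(n/q) yields o(n^2) for the re-seeding with
  the backups of the pairs of each round, and for every single round; the whole run needs R = o(sqrt
  n) as well. Writing answers down forces q to be at least 1 from two states on, so R = o(n/q)
  implies R = o(n). The threshold L/2 is the midpoint of the reward range: two rewards on the same
  side of it differ by at most L/2. An uncovered pair inside a class then keeps a width above D - L
  = gamma D, which is where the admissible \<open>\<eta>\<close> come from. The randomness of the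
  partners matters only through their support: every bound holds for each choice of partners that
  are states.\<close>

lemma coupling_expectation_le_add:
  fixes f g :: pair_fun
  assumes "finite (set_pmf \<mu>)" "finite (set_pmf \<nu>)"
    and "map_pmf fst \<pi> = \<mu>" "map_pmf snd \<pi> = \<nu>"
    and "\<And>x y. x \<in> set_pmf \<mu> \<Longrightarrow> y \<in> set_pmf \<nu> \<Longrightarrow> f x y \<le> g x y + \<delta>"
  shows "measure_pmf.expectation \<pi> (\<lambda>(x, y). f x y)
    \<le> measure_pmf.expectation \<pi> (\<lambda>(x, y). g x y) + \<delta>"
proof -
  have sub: "set_pmf \<pi> \<subseteq> set_pmf \<mu> \<times> set_pmf \<nu>"
    using assms(3,4) by force
  have fin: "finite (set_pmf \<pi>)"
    using sub assms(1,2) by (meson finite_SigmaI finite_subset)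
  have int: "integrable \<pi> h" for h :: "nat \<times> nat \<Rightarrow> real"
    by (rule integrable_measure_pmf_finite[OF fin])
  have "measure_pmf.expectation \<pi> (\<lambda>(x, y). f x y)
    \<le> measure_pmf.expectation \<pi> (\<lambda>z. (case z of (x, y) \<Rightarrow> g x y) + \<delta>)"
    by (rule integral_mono_AE) (use int sub assms(5) in \<open>auto simp: AE_measure_pmf_iff\<close>)
  also have "\<dots> = measure_pmf.expectation \<pi> (\<lambda>(x, y). g x y) + \<delta>"
    using int by (subst Bochner_Integration.integral_add) auto
  finally show ?thesis .
qed

text \<open>Any coupling that is nearly optimal for \<open>g\<close> also competes for
  \<open>f\<close>, at a cost larger by at most \<open>\<delta>\<close>. The argument works with the
  infimum itself; over the reals this is meaningful only for a nonempty family bounded below, and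
  both facts are supplied first.\<close>

lemma wasserstein_le_add:
  assumes fin: "finite (set_pmf \<mu>)" "finite (set_pmf \<nu>)"
    and le: "\<And>x y. x \<in> set_pmf \<mu> \<Longrightarrow> y \<in> set_pmf \<nu> \<Longrightarrow> f x y \<le> g x y + \<delta>"
  shows "wasserstein f \<mu> \<nu> \<le> wasserstein g \<mu> \<nu> + \<delta>"
proof -
  let ?C = "{\<pi>. map_pmf fst \<pi> = \<mu> \<and> map_pmf snd \<pi> = \<nu>}"
  \<comment> \<open>A crude bound on \<open>f\<close> over the two supports; it makes
    \<open>- B\<close> a lower bound for the cost of every coupling.\<close>
  define B where "B = (\<Sum>x\<in>set_pmf \<mu>. \<Sum>y\<in>set_pmf \<nu>. \<bar>f x y\<bar>)"
  have B: "0 \<le> f x y + B" if "x \<in> set_pmf \<mu>" "y \<in> set_pmf \<nu>" for x y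
  proof -
    have "\<bar>f x y\<bar> \<le> (\<Sum>y\<in>set_pmf \<nu>. \<bar>f x y\<bar>)"
      using that fin by (intro member_le_sum) auto
    also have "\<dots> \<le> B"
      unfolding B_def using that fin
      by (intro member_le_sum[where f = "\<lambda>x. \<Sum>y\<in>set_pmf \<nu>. \<bar>f x y\<bar>"]) (auto intro: sum_nonneg)
    finally show ?thesis by linarith
  qed
  have "0 \<le> measure_pmf.expectation \<pi> (\<lambda>(x, y). f x y) + B" if "\<pi> \<in> ?C" for \<pi>
    using coupling_expectation_le_add[OF fin, of \<pi> "\<lambda>_ _. 0" f B] that B
    by (auto simp: case_prod_unfold)
  then have bdd: "bdd_below ((\<lambda>\<pi>. measure_pmf.expectation \<pi> (\<lambda>(x, y). f x y)) ` ?C)"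
    by (intro bdd_belowI2[where m = "-B"]) (smt (verit))
  \<comment> \<open>The independent coupling witnesses nonemptiness.\<close>
  have "pair_pmf \<mu> \<nu> \<in> ?C"
    by (simp add: map_fst_pair_pmf map_snd_pair_pmf)
  then have ne: "?C \<noteq> {}" by blast
  have "wasserstein f \<mu> \<nu> - \<delta> \<le> wasserstein g \<mu> \<nu>"
    unfolding wasserstein_def[of g]
  proof (rule cINF_greatest[OF ne])
    fix \<pi> assume \<pi>: "\<pi> \<in> ?C"
    have "wasserstein f \<mu> \<nu> \<le> measure_pmf.expectation \<pi> (\<lambda>(x, y). f x y)"
      unfolding wasserstein_def by (rule cINF_lower[OF bdd \<pi>])
    also have "\<dots> \<le> measure_pmf.expectation \<pi> (\<lambda>(x, y). g x y) + \<delta>"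
      using \<pi> by (intro coupling_expectation_le_add[OF fin _ _ le]) auto
    finally show "wasserstein f \<mu> \<nu> - \<delta> \<le> measure_pmf.expectation \<pi> (\<lambda>(x, y). g x y)"
      by simp
  qed
  then show ?thesis by simp
qed

text \<open>Swapping coordinates turns couplings of one order into couplings of the other. One
  inclusion for arbitrary marginals, used in both directions, gives equality of the sets of costs.
  This keeps the iterates of \<open>bisim_op\<close> symmetric.\<close>

lemma wasserstein_commute:
  assumes sym: "\<And>x y. f x y = f y x"
  shows "wasserstein f \<mu> \<nu> = wasserstein f \<nu> \<mu>"
proof -
  have sub: "(\<lambda>\<pi>. measure_pmf.expectation \<pi> (\<lambda>(x, y). f x y)) `
      {\<pi>. map_pmf fst \<pi> = \<mu> \<and> map_pmf snd \<pi> = \<nu>}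
    \<subseteq> (\<lambda>\<pi>. measure_pmf.expectation \<pi> (\<lambda>(x, y). f x y)) `
      {\<pi>. map_pmf fst \<pi> = \<nu> \<and> map_pmf snd \<pi> = \<mu>}" for \<mu> \<nu>
  proof (clarify)
    fix \<pi> :: "(nat \<times> nat) pmf"
    let ?\<pi> = "map_pmf prod.swap \<pi>"
    have "measure_pmf.expectation \<pi> (\<lambda>(x, y). f x y)
      = measure_pmf.expectation ?\<pi> (\<lambda>(x, y). f x y)"
      by (auto simp: integral_map_pmf intro!: Bochner_Integration.integral_cong sym)
    moreover have "map_pmf fst ?\<pi> = map_pmf snd \<pi>" "map_pmf snd ?\<pi> = map_pmf fst \<pi>"
      by (simp_all add: pmf.map_comp o_def)
    ultimately show "measure_pmf.expectation \<pi> (\<lambda>(x, y). f x y)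
      \<in> (\<lambda>\<pi>. measure_pmf.expectation \<pi> (\<lambda>(x, y). f x y)) `
        {\<pi>'. map_pmf fst \<pi>' = map_pmf snd \<pi> \<and> map_pmf snd \<pi>' = map_pmf fst \<pi>}"
      by blast
  qed
  show ?thesis
    unfolding wasserstein_def using subset_antisym[OF sub[of \<mu> \<nu>] sub[of \<nu> \<mu>]] by (rule arg_cong)
qed

section \<open>Sup-norm contraction of the backup and the fixed point\<close>

lemma abs_Max_image_diff_le:
  fixes f g :: "'i \<Rightarrow> real"
  assumes "finite I" "I \<noteq> {}" and close: "\<And>i. i \<in> I \<Longrightarrow> \<bar>f i - g i\<bar> \<le> \<delta>"
  shows "\<bar>Max (f ` I) - Max (g ` I)\<bar> \<le> \<delta>"
proof -
  have "Max (f ` I) \<le> Max (g ` I) + \<delta>" if "\<And>i. i \<in> I \<Longrightarrow> \<bar>f i - g i\<bar> \<le> \<delta>" for f g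
  proof -
    have "f i \<le> Max (g ` I) + \<delta>" if "i \<in> I" for i
    proof -
      have "g i \<le> Max (g ` I)"
        using that assms(1) by simp
      then show ?thesis using \<open>\<And>i. i \<in> I \<Longrightarrow> \<bar>f i - g i\<bar> \<le> \<delta>\<close>[OF that] by linarith
    qed
    then show ?thesis using assms(1,2) by simp
  qed
  from this[of f g] this[of g f] close show ?thesis
    by (simp add: abs_le_iff abs_minus_commute)
qed

lemma abs_le_sup_norm:
  assumes "s < state_count M" "s' < state_count M"
  shows "\<bar>f s s'\<bar> \<le> sup_norm M f"
  unfolding sup_norm_def using assms by (intro Max_ge) (auto intro: rev_image_eqI[of "(s, s')"])

lemma mdp_wf_kern_finite:
  assumes "mdp_wf M" "s < state_count M" "a < action_count M"
  shows "finite (set_pmf (kern M s a))" "set_pmf (kern M s a) \<subseteq> {..<state_count M}"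
  using assms unfolding mdp_wf_def by (meson finite_lessThan finite_subset)+

text \<open>Stated for the bare maximum because both \<open>bisim_op\<close> and the value computed
  by \<open>backup\<close> have this form. Closeness on states is enough, since couplings of two
  kernels live on pairs of states.\<close>

lemma backup_contraction:
  assumes wf: "mdp_wf M" and s: "s < state_count M" "s' < state_count M"
    and close: "\<And>x y. x < state_count M \<Longrightarrow> y < state_count M \<Longrightarrow> \<bar>f x y - g x y\<bar> \<le> \<delta>"
  shows "\<bar>Max ((\<lambda>a. \<bar>rew M s a - rew M s' a\<bar> + disc M * wasserstein f (kern M s a) (kern M s' a))
               ` {..<action_count M})
        - Max ((\<lambda>a. \<bar>rew M s a - rew M s' a\<bar> + disc M * wasserstein g (kern M s a) (kern M s' a))
               ` {..<action_count M})\<bar> \<le> disc M * \<delta>"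
proof (rule abs_Max_image_diff_le)
  fix a assume "a \<in> {..<action_count M}"
  then have a: "a < action_count M" by simp
  note k1 = mdp_wf_kern_finite[OF wf s(1) a] and k2 = mdp_wf_kern_finite[OF wf s(2) a]
  have le: "wasserstein f (kern M s a) (kern M s' a) \<le> wasserstein g (kern M s a) (kern M s' a) + \<delta>"
    if "\<And>x y. x < state_count M \<Longrightarrow> y < state_count M \<Longrightarrow> \<bar>f x y - g x y\<bar> \<le> \<delta>" for f g
  proof (rule wasserstein_le_add[OF k1(1) k2(1)])
    fix x y assume "x \<in> set_pmf (kern M s a)" "y \<in> set_pmf (kern M s' a)"
    then show "f x y \<le> g x y + \<delta>"
      using that[of x y] k1(2) k2(2) by force
  qed
  have "\<bar>wasserstein f (kern M s a) (kern M s' a) - wasserstein g (kern M s a) (kern M s' a)\<bar> \<le> \<delta>"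
    using le[of f g] le[of g f] close by (simp add: abs_le_iff abs_minus_commute)
  moreover have "0 \<le> disc M" using wf by (simp add: mdp_wf_def)
  ultimately have "\<bar>disc M * (wasserstein f (kern M s a) (kern M s' a)
      - wasserstein g (kern M s a) (kern M s' a))\<bar> \<le> disc M * \<delta>"
    by (simp add: abs_mult mult_left_mono)
  then show "\<bar>\<bar>rew M s a - rew M s' a\<bar> + disc M * wasserstein f (kern M s a) (kern M s' a)
    - (\<bar>rew M s a - rew M s' a\<bar> + disc M * wasserstein g (kern M s a) (kern M s' a))\<bar> \<le> disc M * \<delta>"
    by (simp only: add_diff_cancel_left right_diff_distrib)
qed (use wf in \<open>auto simp: mdp_wf_def\<close>)

lemma bisim_op_contraction:
  assumes wf: "mdp_wf M" and "0 \<le> \<delta>"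
    and close: "\<And>x y. x < state_count M \<Longrightarrow> y < state_count M \<Longrightarrow> \<bar>f x y - g x y\<bar> \<le> \<delta>"
  shows "\<bar>bisim_op M f s s' - bisim_op M g s s'\<bar> \<le> disc M * \<delta>"
proof (cases "s < state_count M \<and> s' < state_count M \<and> s \<noteq> s'")
  case True
  then show ?thesis
    unfolding bisim_op_def if_P[OF True]
    by (intro backup_contraction wf close) (use True in auto)
next
  case False
  then show ?thesis
    using assms(2) wf unfolding bisim_op_def by (auto simp: mdp_wf_def)
qed

lemma is_pair_fun_bisim_op:
  assumes "is_pair_fun M f"
  shows "is_pair_fun M (bisim_op M f)"
proof -
  have "f x y = f y x" for x y
    using assms by (simp add: is_pair_fun_def)
  then have "wasserstein f \<mu> \<nu> = wasserstein f \<nu> \<mu>" for \<mu> \<nu>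
    by (rule wasserstein_commute)
  then have "bisim_op M f s s' = bisim_op M f s' s" for s s'
    unfolding bisim_op_def by (auto simp: abs_minus_commute)
  then show ?thesis
    by (auto simp: is_pair_fun_def bisim_op_def)
qed

lemma bisim_op_fixed_point_unique:
  assumes wf: "mdp_wf M"
    and f: "is_pair_fun M f" "bisim_op M f = f" and g: "is_pair_fun M g" "bisim_op M g = g"
  shows "f = g"
proof -
  define \<delta> where "\<delta> = sup_norm M (\<lambda>x y. f x y - g x y)"
  have close: "\<bar>f x y - g x y\<bar> \<le> \<delta>" if "x < state_count M" "y < state_count M" for x y
    unfolding \<delta>_def by (rule abs_le_sup_norm[OF that])
  have n: "0 < state_count M" using wf by (simp add: mdp_wf_def)
  have nn: "0 \<le> \<delta>" using close[OF n n] by linarith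
  have "\<bar>f x y - g x y\<bar> \<le> disc M * \<delta>" for x y
    using bisim_op_contraction[of M \<delta> f g x y] wf nn close f g by simp
  then have "\<delta> \<le> disc M * \<delta>"
    unfolding \<delta>_def[unfolded sup_norm_def] sup_norm_def using n by (subst Max_le_iff) auto
  moreover have "disc M < 1" using wf by (simp add: mdp_wf_def)
  ultimately have "\<delta> = 0" using nn by (smt (verit) mult_le_cancel_right1)
  then have "f x y = g x y" if "x < state_count M" "y < state_count M" for x y
    using close[OF that] by simp
  then show "f = g"
    using f(1) g(1) unfolding is_pair_fun_def by (metis ext)
qed

text \<open>Picard iteration from zero. Convergence is obtained entry by entry, from a telescoping
  sum dominated by a geometric series, rather than in a metric space of pair functions.\<close>

lemma bisim_op_fixed_point_exists:
  assumes wf: "mdp_wf M"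
  shows "\<exists>f. is_pair_fun M f \<and> bisim_op M f = f"
proof -
  let ?n = "state_count M"
  have \<gamma>: "0 \<le> disc M" "disc M < 1" and n: "0 < ?n" using wf by (auto simp: mdp_wf_def)
  define F where "F k = (bisim_op M ^^ k) (\<lambda>_ _. 0)" for k
  have F_Suc: "F (Suc k) = bisim_op M (F k)" for k by (simp add: F_def)
  have pair: "is_pair_fun M (F k)" for k
    by (induction k) (auto simp: F_Suc is_pair_fun_bisim_op, simp add: F_def is_pair_fun_def)
  define B where "B = sup_norm M (\<lambda>x y. F 1 x y - F 0 x y)"
  have B: "\<bar>F 1 x y - F 0 x y\<bar> \<le> B" if "x < ?n" "y < ?n" for x y
    unfolding B_def by (rule abs_le_sup_norm[OF that])
  have B0: "0 \<le> B" using B[OF n n] by linarith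
  have step: "\<bar>F (Suc k) x y - F k x y\<bar> \<le> disc M ^ k * B" if "x < ?n" "y < ?n" for x y k
    using that
  proof (induction k arbitrary: x y)
    case 0
    then show ?case using B by simp
  next
    case (Suc k)
    have "0 \<le> disc M ^ k * B" using \<gamma> B0 by simp
    with bisim_op_contraction[of M "disc M ^ k * B" "F (Suc k)" "F k" x y] wf Suc.IH show ?case
      by (simp add: F_Suc mult.assoc)
  qed
  have conv: "convergent (\<lambda>k. F k x y)" for x y
  proof (cases "x < ?n \<and> y < ?n")
    case True
    have "summable (\<lambda>k. disc M ^ k * B)"
      using \<gamma> by (intro summable_mult2 summable_geometric) simp
    then have "summable (\<lambda>k. F (Suc k) x y - F k x y)"
      by (rule summable_comparison_test[rotated]) (use step True in auto)
    then have "convergent (\<lambda>k. \<Sum>i<k. F (Suc i) x y - F i x y)"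
      by (simp add: summable_iff_convergent)
    then have "convergent (\<lambda>k. F k x y - F 0 x y)"
      using sum_lessThan_telescope[of "\<lambda>k. F k x y"] by simp
    then have "convergent (\<lambda>k. (F k x y - F 0 x y) + F 0 x y)"
      by (intro convergent_add convergent_const)
    then show ?thesis by simp
  next
    case False
    then have "F k x y = 0" for k using pair[of k] by (auto simp: is_pair_fun_def)
    then show ?thesis by (simp add: convergent_const)
  qed
  define f where "f x y = lim (\<lambda>k. F k x y)" for x y
  have lim: "(\<lambda>k. F k x y) \<longlonglongrightarrow> f x y" for x y
    unfolding f_def using conv by (simp add: convergent_LIMSEQ_iff)
  have "is_pair_fun M f"
    using pair unfolding is_pair_fun_def f_def by simp
  moreover have "bisim_op M f = f"
  proof (intro ext)
    fix x y
    \<comment> \<open>The sum of all entrywise errors dominates the largest one, and its limit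
      follows directly from the entrywise limits.\<close>
    define \<delta> where "\<delta> k = (\<Sum>x<?n. \<Sum>y<?n. \<bar>F k x y - f x y\<bar>)" for k
    have "\<delta> \<longlonglongrightarrow> (\<Sum>x<?n. \<Sum>y<?n. \<bar>f x y - f x y\<bar>)"
      unfolding \<delta>_def by (intro tendsto_intros lim)
    then have \<delta>: "(\<lambda>k. disc M * \<delta> k) \<longlonglongrightarrow> 0"
      by (auto intro: tendsto_mult_right_zero)
    have le: "\<bar>F k x y - f x y\<bar> \<le> \<delta> k" if "x < ?n" "y < ?n" for x y k
    proof -
      have "\<bar>F k x y - f x y\<bar> \<le> (\<Sum>y<?n. \<bar>F k x y - f x y\<bar>)"
        using that by (intro member_le_sum) auto
      also have "\<dots> \<le> \<delta> k"
        unfolding \<delta>_def using that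
        by (intro member_le_sum[where f = "\<lambda>x. \<Sum>y<?n. \<bar>F k x y - f x y\<bar>"]) (auto intro: sum_nonneg)
      finally show ?thesis .
    qed
    have nn: "0 \<le> \<delta> k" for k unfolding \<delta>_def by (intro sum_nonneg) auto
    have "\<bar>F (Suc k) x y - bisim_op M f x y\<bar> \<le> disc M * \<delta> k" for k
      unfolding F_Suc using bisim_op_contraction[of M "\<delta> k" "F k" f x y] wf nn le by simp
    then have "(\<lambda>k. F (Suc k) x y - bisim_op M f x y) \<longlonglongrightarrow> 0"
      by (intro Lim_null_comparison[OF _ \<delta>]) auto
    then have "(\<lambda>k. F (Suc k) x y) \<longlonglongrightarrow> bisim_op M f x y"
      by (simp add: LIM_zero_iff)
    then show "bisim_op M f x y = f x y"
      using LIMSEQ_Suc[OF lim] LIMSEQ_unique by blast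
  qed
  ultimately show ?thesis by blast
qed

text \<open>Justifies the definite description in \<open>bisim_metric\<close>; the error analysis
  knows the metric only through these two facts.\<close>

lemma bisim_metric_fixed_point:
  assumes "mdp_wf M"
  shows "is_pair_fun M (bisim_metric M)" "bisim_op M (bisim_metric M) = bisim_metric M"
proof -
  have "\<exists>!f. is_pair_fun M f \<and> bisim_op M f = f"
    using bisim_op_fixed_point_exists[OF assms] bisim_op_fixed_point_unique[OF assms] by blast
  from theI'[OF this] show "is_pair_fun M (bisim_metric M)"
      "bisim_op M (bisim_metric M) = bisim_metric M"
    unfolding bisim_metric_def by auto
qed

section \<open>Error of the restricted iteration\<close>

lemma fst_sweep:
  "fst (sweep H M ini C t) =
     (\<lambda>p. if p \<in> C then Some (fst (backup H M (read_iter M ini t) (Min p) (Max p))) else t p)"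
  by (simp add: sweep_def Let_def)

lemma fst_backup:
  "fst (backup H M (read_iter M ini t) s s') =
     Max ((\<lambda>a. \<bar>rew M s a - rew M s' a\<bar>
        + disc M * wasserstein (iter_fun M ini t) (kern M s a) (kern M s' a)) ` {..<action_count M})"
  unfolding backup_def transport_def iter_fun_def Let_def by simp

lemma sweeps_uncovered: "p \<notin> C \<Longrightarrow> fst (sweeps H M ini C K t) p = t p"
  by (induction K) (auto simp: bind_timed_def fst_sweep)

lemma init_fun_diag:
  assumes "0 < action_count M"
  shows "init_fun M ini s s = 0"
  using assms by (cases ini) (auto simp: init_fun_def reward_dist_def image_constant_conv)

lemma iter_fun_empty:
  assumes "0 < action_count M"
  shows "iter_fun M ini Map.empty = init_fun M ini"
  using init_fun_diag[OF assms] by (auto simp: iter_fun_def read_iter_def fun_eq_iff)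

lemma coverage_floor_ge:
  shows "0 \<le> coverage_floor M ini C"
    and "s < state_count M \<Longrightarrow> s' < state_count M \<Longrightarrow> {s, s'} \<notin> C \<Longrightarrow>
      \<bar>bisim_metric M s s' - init_fun M ini s s'\<bar> \<le> coverage_floor M ini C"
proof -
  let ?S = "{\<bar>bisim_metric M s s' - init_fun M ini s s'\<bar> |s s'.
       s < state_count M \<and> s' < state_count M \<and> {s, s'} \<notin> C}"
  have "?S \<subseteq> (\<lambda>(s, s'). \<bar>bisim_metric M s s' - init_fun M ini s s'\<bar>) `
      ({..<state_count M} \<times> {..<state_count M})"
    by auto
  then have fin: "finite (insert 0 ?S)" by (simp add: finite_subset)
  show "0 \<le> coverage_floor M ini C"
    unfolding coverage_floor_def by (rule Max_ge[OF fin]) simp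
  show "\<bar>bisim_metric M s s' - init_fun M ini s s'\<bar> \<le> coverage_floor M ini C"
    if "s < state_count M" "s' < state_count M" "{s, s'} \<notin> C"
    unfolding coverage_floor_def by (rule Max_ge[OF fin]) (use that in blast)
qed

lemma covered_error_le:
  assumes "0 \<le> b"
    and "\<And>s s'. s < state_count M \<Longrightarrow> s' < state_count M \<Longrightarrow> {s, s'} \<in> C \<Longrightarrow>
      \<bar>f s s' - bisim_metric M s s'\<bar> \<le> b"
  shows "covered_error M C f \<le> b"
proof -
  let ?S = "{\<bar>f s s' - bisim_metric M s s'\<bar> |s s'.
       s < state_count M \<and> s' < state_count M \<and> {s, s'} \<in> C}"
  have "?S \<subseteq> (\<lambda>(s, s'). \<bar>f s s' - bisim_metric M s s'\<bar>) `
      ({..<state_count M} \<times> {..<state_count M})"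
    by auto
  then have "finite (insert 0 ?S)" by (simp add: finite_subset)
  then show ?thesis
    unfolding covered_error_def using assms by (subst Max_le_iff) auto
qed

text \<open>The recursion in closed form. Covered and uncovered pairs need a joint induction, since
  a backup reads both kinds. All entries are within the maximum of gamma^K Delta_0 and the floor,
  because gamma times the floor is below the floor; one more backup multiplies both terms by gamma.
  Uncovered errors re-enter unchanged in each sweep, so the floor keeps exactly one factor gamma and
  does not accumulate.\<close>

lemma restricted_iteration_error:
  assumes wf: "mdp_wf M" and s: "s < state_count M" "s' < state_count M"
  shows "\<bar>iter_fun M ini (fst (sweeps H M ini C K Map.empty)) s s' - bisim_metric M s s'\<bar>
    \<le> (if {s, s'} \<in> C then max (disc M ^ K * init_gap M ini) (disc M * coverage_floor M ini C)
       else coverage_floor M ini C)"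
  using s
proof (induction K arbitrary: s s')
  case 0
  have A: "0 < action_count M" using wf by (simp add: mdp_wf_def)
  have "\<bar>init_fun M ini s s' - bisim_metric M s s'\<bar> \<le> init_gap M ini"
    unfolding init_gap_def by (rule abs_le_sup_norm[OF 0])
  then show ?case
    using coverage_floor_ge(2)[OF 0, of C ini]
    by (auto simp: iter_fun_empty[OF A] abs_minus_commute)
next
  case (Suc K)
  let ?t = "fst (sweeps H M ini C K Map.empty)"
  let ?F = "coverage_floor M ini C" and ?G = "init_gap M ini"
  have \<gamma>: "0 \<le> disc M" "disc M < 1" using wf by (auto simp: mdp_wf_def)
  have F: "0 \<le> ?F" "disc M * ?F \<le> ?F"
    using coverage_floor_ge(1)[of M ini C] \<gamma> by (auto simp: mult_left_le_one_le)
  note d = bisim_metric_fixed_point[OF wf]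
  consider "{s, s'} \<notin> C" | "{s, s'} \<in> C" "s = s'" | "{s, s'} \<in> C" "s \<noteq> s'" by blast
  then show ?case
  proof cases
    case 1
    then have "iter_fun M ini (fst (sweeps H M ini C (Suc K) Map.empty)) s s' = iter_fun M ini ?t s s'"
      unfolding iter_fun_def read_iter_def by (simp add: bind_timed_def fst_sweep)
    then show ?thesis using Suc.IH[OF Suc.prems] 1 by simp
  next
    \<comment> \<open>A diagonal key may belong to \<open>C\<close>, but reading the diagonal always
      returns 0, which is exact.\<close>
    case 2
    moreover have "bisim_metric M s s = 0" using d(1) by (simp add: is_pair_fun_def)
    ultimately show ?thesis using F \<gamma>
      by (auto simp: iter_fun_def read_iter_def intro!: max.coboundedI2)
  next
    case 3
    \<comment> \<open>A sweep backs up an unordered key with its smaller state first; symmetry of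
      the metric carries the estimate back to the given order.\<close>
    define x y where "x = Min {s, s'}" and "y = Max {s, s'}"
    have xy: "x < state_count M" "y < state_count M" "x \<noteq> y" "{x, y} = {s, s'}"
      using 3 Suc.prems by (auto simp: x_def y_def min_def max_def)
    have sym: "bisim_metric M s s' = bisim_metric M x y"
      using xy(4) d(1) by (auto simp: doubleton_eq_iff is_pair_fun_def)
    have "iter_fun M ini (fst (sweeps H M ini C (Suc K) Map.empty)) s s'
      = fst (backup H M (read_iter M ini ?t) x y)"
      using 3 by (subst iter_fun_def, subst read_iter_def) (simp add: bind_timed_def fst_sweep x_def y_def)
    moreover have "\<bar>fst (backup H M (read_iter M ini ?t) x y) - bisim_op M (bisim_metric M) x y\<bar>
      \<le> disc M * max (disc M ^ K * ?G) ?F"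
    proof -
      have P: "x < state_count M \<and> y < state_count M \<and> x \<noteq> y" using xy by simp
      have close: "\<bar>iter_fun M ini ?t x y - bisim_metric M x y\<bar> \<le> max (disc M ^ K * ?G) ?F"
        if "x < state_count M" "y < state_count M" for x y
        using Suc.IH[OF that] F(2) by (auto split: if_splits)
      show ?thesis
        unfolding fst_backup bisim_op_def if_P[OF P]
        by (intro backup_contraction wf close xy)
    qed
    ultimately have "\<bar>iter_fun M ini (fst (sweeps H M ini C (Suc K) Map.empty)) s s' - bisim_metric M s s'\<bar>
      \<le> disc M * max (disc M ^ K * ?G) ?F"
      using sym d(2) by metis
    also have "\<dots> = max (disc M ^ Suc K * ?G) (disc M * ?F)"
      using \<gamma> by (simp add: max_mult_distrib_left mult.assoc)
    finally show ?thesis using 3 by simp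
  qed
qed

text \<open>From gamma \<le> exp(-(1 - gamma)), the power gamma^K is at most exp(-(1 - gamma) K),
  and the choice of K makes this at most \<open>\<epsilon>\<close> over the initial gap. A gap
  already below \<open>\<epsilon>\<close> is treated apart: it may be zero, and then powers at most
  1 suffice.\<close>

lemma discount_pow_sweep_count:
  assumes wf: "mdp_wf M" and \<epsilon>: "0 < \<epsilon>"
  shows "disc M ^ sweep_count M ini \<epsilon> * init_gap M ini \<le> \<epsilon>"
proof (cases "init_gap M ini \<le> \<epsilon>")
  case True
  have \<gamma>: "0 \<le> disc M" "disc M < 1" using wf by (auto simp: mdp_wf_def)
  have n: "0 < state_count M" using wf by (simp add: mdp_wf_def)
  have "0 \<le> init_gap M ini" unfolding init_gap_def
    by (rule order_trans[OF abs_ge_zero abs_le_sup_norm[OF n n]])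
  then have "disc M ^ sweep_count M ini \<epsilon> * init_gap M ini \<le> init_gap M ini"
    using \<gamma> by (intro mult_left_le_one_le) (auto intro: power_le_one)
  then show ?thesis using True by linarith
next
  case False
  let ?K = "sweep_count M ini \<epsilon>" and ?G = "init_gap M ini"
  have \<gamma>: "0 \<le> disc M" "disc M < 1" using wf by (auto simp: mdp_wf_def)
  have "ln (?G / \<epsilon>) / (1 - disc M) \<le> real ?K"
    unfolding sweep_count_def by (rule real_nat_ceiling_ge)
  then have K: "ln (?G / \<epsilon>) \<le> (1 - disc M) * real ?K"
    using \<gamma> by (simp add: field_simps)
  have "disc M \<le> exp (- (1 - disc M))"
    using exp_ge_add_one_self[of "- (1 - disc M)"] by simp
  then have "disc M ^ ?K \<le> exp (- (1 - disc M)) ^ ?K"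
    using \<gamma> by (intro power_mono) auto
  also have "\<dots> = exp (- ((1 - disc M) * real ?K))"
    by (simp add: exp_of_nat_mult[symmetric] algebra_simps)
  also have "\<dots> \<le> exp (- ln (?G / \<epsilon>))" using K by simp
  also have "\<dots> = \<epsilon> / ?G" using False \<epsilon> by (simp add: exp_minus)
  finally show ?thesis using False \<epsilon> by (simp add: field_simps)
qed

lemma single_build_accuracy:
  assumes wf: "mdp_wf M" and \<epsilon>: "0 < \<epsilon>" and K: "K = sweep_count M ini \<epsilon>"
  shows "covered_error M C (iter_fun M ini (fst (sweeps H M ini C K Map.empty)))
    \<le> disc M * coverage_floor M ini C + \<epsilon>"
proof (rule covered_error_le)
  have \<gamma>: "0 \<le> disc M" using wf by (auto simp: mdp_wf_def)
  have F: "0 \<le> disc M * coverage_floor M ini C"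
    using \<gamma> coverage_floor_ge(1) by (intro mult_nonneg_nonneg) auto
  then show "0 \<le> disc M * coverage_floor M ini C + \<epsilon>" using \<epsilon> by simp
  fix s s' assume s: "s < state_count M" "s' < state_count M" "{s, s'} \<in> C"
  show "\<bar>iter_fun M ini (fst (sweeps H M ini C K Map.empty)) s s' - bisim_metric M s s'\<bar>
    \<le> disc M * coverage_floor M ini C + \<epsilon>"
    using restricted_iteration_error[OF wf s(1,2), of ini H C K] s(3)
      discount_pow_sweep_count[OF wf \<epsilon>, of ini] F \<epsilon> K by simp
qed

text \<open>The factor 2 absorbs the rounding up: \<open>log_gap\<close> is at least 1 and 1 - gamma
  is at most 1, so the quotient is at least 1 and can pay for the ceiling.\<close>

lemma sweep_count_le:
  assumes wf: "mdp_wf M"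
  shows "real (sweep_count M ini \<epsilon>) \<le> 2 * (log_gap M ini \<epsilon> / (1 - disc M))"
proof -
  have \<gamma>: "0 \<le> disc M" "disc M < 1" using wf by (auto simp: mdp_wf_def)
  let ?x = "ln (init_gap M ini / \<epsilon>) / (1 - disc M)" and ?y = "log_gap M ini \<epsilon> / (1 - disc M)"
  have "?x \<le> ?y" unfolding log_gap_def using \<gamma> by (intro divide_right_mono) auto
  moreover have "1 \<le> ?y" unfolding log_gap_def using \<gamma> by (simp add: le_divide_eq)
  ultimately have "real_of_int \<lceil>?x\<rceil> \<le> 2 * ?y" "0 \<le> 2 * ?y" by linarith+
  then show ?thesis unfolding sweep_count_def by simp
qed

section \<open>Running times of the building blocks\<close>

definition covers_states :: "mdp \<Rightarrow> nat set set \<Rightarrow> bool" where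
  "covers_states M C \<longleftrightarrow> C \<subseteq> (\<lambda>(s, s'). {s, s'}) ` ({..<state_count M} \<times> {..<state_count M})"

lemma covers_states_finite: "covers_states M C \<Longrightarrow> finite C"
  unfolding covers_states_def by (erule finite_subset) simp

lemma covers_states_Un: "covers_states M C \<Longrightarrow> covers_states M D \<Longrightarrow> covers_states M (C \<union> D)"
  unfolding covers_states_def by simp

lemma covers_states_Min_Max:
  assumes "covers_states M C" "p \<in> C"
  shows "Min p < state_count M" "Max p < state_count M"
  using assms unfolding covers_states_def by auto

lemma mdpsD:
  assumes "M \<in> mdps A m"
  shows "mdp_wf M" "action_count M = A" "0 < state_count M"
    and "s < state_count M \<Longrightarrow> a < A \<Longrightarrow> finite (set_pmf (kern M s a))"
    and "s < state_count M \<Longrightarrow> a < A \<Longrightarrow> card (set_pmf (kern M s a)) \<le> m"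
  using assms unfolding mdps_def mdp_wf_def by (auto intro: finite_subset)

lemma read_iter_time:
  "1 \<le> snd (read_iter M ini t x y)" "snd (read_iter M ini t x y) \<le> 1 + real (action_count M)"
  by (auto simp: read_iter_def split: option.split)

lemma routine_costs_ot:
  assumes "routine_costs H"
  shows "mono (ot_time H)" "0 \<le> ot_time H N"
  using assms unfolding routine_costs_def by auto

lemma transport_time_le:
  assumes H: "routine_costs H" and "finite (set_pmf \<mu>)" "finite (set_pmf \<nu>)"
    and card: "card (set_pmf \<mu>) \<le> m" "card (set_pmf \<nu>) \<le> m"
    and b: "\<And>x y. snd (rd x y) \<le> b" "0 \<le> b"
  shows "snd (transport H rd \<mu> \<nu>) \<le> (2 * real m)\<^sup>2 * b + ot_time H (2 * m)"
proof -
  let ?U = "set_pmf \<mu> \<union> set_pmf \<nu>"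
  have U: "card ?U \<le> 2 * m" using card card_Un_le[of "set_pmf \<mu>" "set_pmf \<nu>"] by linarith
  have "(\<Sum>x\<in>?U. \<Sum>y\<in>?U. snd (rd x y)) \<le> (\<Sum>x\<in>?U. \<Sum>y\<in>?U. b)"
    by (intro sum_mono b)
  also have "\<dots> = (real (card ?U))\<^sup>2 * b" by (simp add: power2_eq_square)
  also have "\<dots> \<le> (2 * real m)\<^sup>2 * b"
    using U b(2) by (intro mult_right_mono power_mono) auto
  finally show ?thesis
    unfolding transport_def Let_def using monoD[OF routine_costs_ot(1)[OF H] U] by simp
qed

lemma backup_time_le:
  assumes H: "routine_costs H" and M: "M \<in> mdps A m"
    and s: "s < state_count M" "s' < state_count M"
    and b: "\<And>x y. snd (rd x y) \<le> b" "0 \<le> b"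
  shows "snd (backup H M rd s s') \<le> 1 + real A * (1 + (2 * real m)\<^sup>2 * b + ot_time H (2 * m))"
proof -
  have "(\<Sum>a<A. 1 + snd (transport H rd (kern M s a) (kern M s' a)))
    \<le> (\<Sum>a<A. 1 + ((2 * real m)\<^sup>2 * b + ot_time H (2 * m)))"
    using mdpsD(4,5)[OF M] s by (intro sum_mono add_left_mono transport_time_le H b) auto
  then show ?thesis
    unfolding backup_def using mdpsD(2)[OF M] by (simp add: add.assoc)
qed

lemma backup_iter_time_le:
  assumes "routine_costs H" "M \<in> mdps A m" "s < state_count M" "s' < state_count M"
  shows "snd (backup H M (read_iter M ini t) s s') \<le> backup_cost H A m"
  unfolding backup_cost_def
  using assms read_iter_time(2)[of M ini t] mdpsD(2)[OF assms(2)] by (intro backup_time_le) auto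

text \<open>The unit charge in \<open>backup\<close> pays for this. It makes sweep times nonnegative
  and is the source of the quadratic lower bound on a full sweep for fixed \<open>m\<close>.\<close>

lemma backup_time_ge_1:
  assumes "routine_costs H" and "\<And>x y. 0 \<le> snd (rd x y)"
  shows "1 \<le> snd (backup H M rd s s')"
proof -
  have "0 \<le> snd (transport H rd \<mu> \<nu>)" for \<mu> \<nu>
    unfolding transport_def Let_def using assms routine_costs_ot(2)
    by (auto intro!: add_nonneg_nonneg sum_nonneg)
  then show ?thesis unfolding backup_def by (auto intro!: sum_nonneg add_nonneg_nonneg)
qed

lemma backup_cost_ge_1: "routine_costs H \<Longrightarrow> 1 \<le> backup_cost H A m"
  unfolding backup_cost_def using routine_costs_ot(2) by auto

lemma sweep_time_le:
  assumes H: "routine_costs H" and M: "M \<in> mdps A m" and C: "covers_states M C"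
  shows "snd (sweep H M ini C t) \<le> real (card C) * backup_cost H A m"
  unfolding sweep_def Let_def snd_conv
  by (rule sum_bounded_above) (intro backup_iter_time_le[OF H M] covers_states_Min_Max[OF C])

lemma sweep_time_nonneg: "routine_costs H \<Longrightarrow> 0 \<le> snd (sweep H M ini C t)"
  unfolding sweep_def Let_def snd_conv
  by (intro sum_nonneg order_trans[OF zero_le_one backup_time_ge_1] order_trans[OF zero_le_one read_iter_time(1)])

lemma sweeps_time_le:
  assumes "routine_costs H" "M \<in> mdps A m" "covers_states M C"
  shows "snd (sweeps H M ini C K t) \<le> real K * (real (card C) * backup_cost H A m)"
proof (induction K)
  case (Suc K)
  then show ?case
    using sweep_time_le[OF assms, of ini "fst (sweeps H M ini C K t)"]
    by (simp add: bind_timed_def algebra_simps)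
qed simp

lemma sweeps_time_nonneg:
  assumes "routine_costs H"
  shows "0 \<le> snd (sweeps H M ini C K t)"
  by (induction K) (auto simp: bind_timed_def intro!: add_nonneg_nonneg sweep_time_nonneg[OF assms])

lemma embed_time_nonneg:
  assumes "routine_costs H" "\<And>x y. 0 \<le> snd (rd x y)"
  shows "0 \<le> snd (embed H M k lm rd)"
  using assms unfolding embed_def snd_conv routine_costs_def
  by (intro add_nonneg_nonneg sum_nonneg sum_list_nonneg mult_nonneg_nonneg) auto

lemma embed_points:
  "length (fst (embed H M k lm rd)) = state_count M"
  "x \<in> set (fst (embed H M k lm rd)) \<Longrightarrow> length x = k"
  by (auto simp: embed_def landmark_mds_def Let_def)

section \<open>Cost of the embedding\<close>

text \<open>Named so that one pair of constants serves every \<open>m\<close>, \<open>k\<close>,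
  landmark list and MDP. The reader \<open>rd\<close> is arbitrary because the pipeline re-embeds
  iterates whose tables change from round to round.\<close>

definition embed_bound :: "routines \<Rightarrow> nat \<Rightarrow> real \<Rightarrow> nat \<Rightarrow> bool" where
  "embed_bound H A c e \<longleftrightarrow> (\<forall>m k lm. \<forall>M\<in>mdps A m. \<forall>rd. 1 \<le> k \<and> landmarks H M k lm \<and>
      (\<forall>x y. snd (rd x y) \<le> 1 + real A) \<longrightarrow>
      snd (embed H M k lm rd) \<le> c * (real (state_count M) * real k ^ e))"

lemma embed_bound_exists:
  assumes H: "routine_costs H"
  shows "\<exists>c>0. \<exists>e. embed_bound H A c e"
proof -
  obtain c1 e1 where lmc: "\<And>k. 1 \<le> k \<Longrightarrow> real (lm_count H k) \<le> c1 * real k ^ e1"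
    using H unfolding routine_costs_def by blast
  obtain c2 e2 where eig: "\<And>l. eig_time H l \<le> c2 * (1 + real l) ^ e2"
    using H unfolding routine_costs_def by blast
  \<comment> \<open>The terms 1 + A, 1, 1 and \<bar>c2\<bar> pay for reading the landmark columns,
    the Gram matrix, the projections and the eigen-step; the power comes from expanding
    \<open>P\<close> in \<open>Q\<close>.\<close>
  define c where "c = (3 + real A + \<bar>c2\<bar>) * (1 + \<bar>c1\<bar>) ^ Suc e2"
  have "snd (embed H M k lm rd) \<le> c * (real (state_count M) * real k ^ (1 + e1 * Suc e2))"
    if M: "M \<in> mdps A m" and k: "1 \<le> k" and lm: "landmarks H M k lm"
      and rd: "\<And>x y. snd (rd x y) \<le> 1 + real A" for m k lm M rd
  proof -
    define n l where "n = real (state_count M)" and "l = real (length lm)"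
    define P where "P = (1 + \<bar>c1\<bar>) * real k ^ e1"
    have n: "1 \<le> n" using mdpsD(3)[OF M] by (simp add: n_def)
    have k1: "1 \<le> real k ^ e1" using k by simp
    have "l \<le> real (lm_count H k)" and ln: "l \<le> n" and l0: "0 \<le> l"
      using lm by (auto simp: landmarks_def l_def n_def)
    then have "l \<le> c1 * real k ^ e1" using lmc[OF k] by linarith
    also have "\<dots> \<le> \<bar>c1\<bar> * real k ^ e1" by (intro mult_right_mono) auto
    finally have lP: "1 + l \<le> P" using k1 by (simp add: P_def algebra_simps)
    have P1: "1 \<le> P" using lP l0 by linarith
    \<comment> \<open>A common majorant for the four parts of the cost: \<open>P\<close> bounds one
      plus the number of landmarks, \<open>P ^ e2\<close> the eigen-step, and k P the projection of
      one state. The extra factor \<open>P\<close> ensures that \<open>P\<close> itself is dominated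
      even when \<open>e2\<close> is 0.\<close>
    define Q where "Q = real k * P ^ Suc e2"
    have P_pow: "1 \<le> P ^ e2" using P1 by simp
    have "P * 1 \<le> P * P ^ e2" using P1 P_pow by (intro mult_left_mono) auto
    then have PQ': "P \<le> P ^ Suc e2" by simp
    have kx: "x \<le> real k * x" if "0 \<le> x" for x
      using k that mult_right_mono[of 1 "real k" x] by simp
    have "P ^ Suc e2 \<le> Q" unfolding Q_def by (rule kx) (use P1 in simp)
    moreover have "P ^ e2 \<le> P ^ Suc e2" using P1 by (intro power_increasing) auto
    moreover have "real k * P \<le> Q" unfolding Q_def by (intro mult_left_mono PQ') simp
    ultimately have PQ: "P \<le> Q" "P ^ e2 \<le> Q" "real k * P \<le> Q"
      using PQ' by linarith+
    have Q0: "0 \<le> Q" using PQ P1 by linarith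
    have "(\<Sum>s<state_count M. \<Sum>l\<leftarrow>lm. snd (rd s l)) \<le> (\<Sum>s<state_count M. l * (1 + real A))"
      unfolding l_def using sum_list_mono[of lm "\<lambda>l. snd (rd _ l)" "\<lambda>_. 1 + real A"] rd
      by (intro sum_mono) (simp add: sum_list_triv)
    also have "\<dots> = n * (l * (1 + real A))" by (simp add: n_def)
    also have "\<dots> \<le> n * (Q * (1 + real A))"
      using n lP PQ(1) by (intro mult_left_mono mult_right_mono) auto
    finally have t1: "(\<Sum>s<state_count M. \<Sum>l\<leftarrow>lm. snd (rd s l)) \<le> (1 + real A) * (n * Q)"
      by (simp add: algebra_simps)
    \<comment> \<open>There are at most as many landmarks as states, so the Gram matrix costs no
      more than the landmark columns.\<close>
    have "l ^ 2 \<le> n * l" using ln l0 by (simp add: power2_eq_square mult_right_mono)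
    also have "\<dots> \<le> n * Q" using n lP PQ(1) by (intro mult_left_mono) auto
    finally have t2: "l ^ 2 \<le> n * Q" .
    have "eig_time H (length lm) \<le> c2 * (1 + l) ^ e2" using eig by (simp add: l_def)
    also have "\<dots> \<le> \<bar>c2\<bar> * P ^ e2"
      using lP l0 by (intro mult_mono power_mono) auto
    also have "\<dots> \<le> \<bar>c2\<bar> * Q" using PQ by (intro mult_left_mono) auto
    also have "\<dots> \<le> \<bar>c2\<bar> * (n * Q)"
      using n Q0 by (intro mult_left_mono) (auto simp: mult_le_cancel_right1)
    finally have t3: "eig_time H (length lm) \<le> \<bar>c2\<bar> * (n * Q)" .
    have "real k * (1 + l) \<le> Q"
      using lP PQ(3) by (intro order_trans[OF mult_left_mono PQ(3)]) auto
    then have t4: "n * (real k * (1 + l)) \<le> n * Q" using n by (intro mult_left_mono) auto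
    have "snd (embed H M k lm rd) \<le> (3 + real A + \<bar>c2\<bar>) * (n * Q)"
      unfolding embed_def snd_conv n_def[symmetric] l_def[symmetric]
      using t1 t2 t3 t4 by (simp add: algebra_simps)
    also have "\<dots> = c * (n * real k ^ (1 + e1 * Suc e2))"
      unfolding c_def Q_def P_def by (simp add: power_mult_distrib power_mult power_add)
    finally show ?thesis unfolding n_def .
  qed
  moreover have "c > 0" unfolding c_def by (intro mult_pos_pos zero_less_power) auto
  ultimately show ?thesis unfolding embed_bound_def by blast
qed

lemma embed_iter_time_le:
  assumes "embed_bound H A c e" "M \<in> mdps A m" "1 \<le> k" "landmarks H M k lm"
  shows "snd (embed H M k lm (read_iter M ini t)) \<le> c * (real (state_count M) * real k ^ e)"
  using assms read_iter_time(2)[of M ini t] mdpsD(2)[OF assms(2)] unfolding embed_bound_def by auto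

section \<open>Cost and size of the retrieved cover\<close>

lemma ann_indexD:
  assumes "ann_index H q" "1 \<le> k" "1 \<le> k'" "xs \<noteq> []" "\<And>x. x \<in> set xs \<Longrightarrow> length x = k"
  shows "s < length xs \<Longrightarrow> set (fst (ann_query H z xs k' s)) \<subseteq> {..<length xs}"
    and "s < length xs \<Longrightarrow> min k' (length xs - 1) \<le> length (fst (ann_query H z xs k' s))"
    and "s < length xs \<Longrightarrow> length (fst (ann_query H z xs k' s)) \<le> k'"
    and "s < length xs \<Longrightarrow> real (length (fst (ann_query H z xs k' s))) \<le> snd (ann_query H z xs k' s)"
    and "ann_build_time H k (length xs) + (\<Sum>s<length xs. snd (ann_query H z xs k' s))
          \<le> real (length xs) * q k k' (length xs)"
    and "0 \<le> ann_build_time H k n"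
  using assms unfolding ann_index_def Let_def by blast+

text \<open>The index contract bounds total time from above by n q, while each query costs at least
  the length of its answer. Applying it to one concrete input turns this into a lower bound on
  \<open>q\<close> itself, and in particular into its nonnegativity.\<close>

lemma query_time_ge:
  assumes q: "ann_index H q" and k: "1 \<le> k" "1 \<le> k'" and n: "0 < n"
  shows "real (min k' (n - 1)) \<le> q k k' n"
proof -
  \<comment> \<open>Any n points of dimension k would do; a list of n equal points is the
    simplest.\<close>
  define xs where "xs = replicate n (replicate k (0::real))"
  have xs: "length xs = n" "xs \<noteq> []" "\<And>x. x \<in> set xs \<Longrightarrow> length x = k"
    using n by (auto simp: xs_def)
  note D = ann_indexD[OF q k xs(2,3), unfolded xs(1)]
  have "real n * real (min k' (n - 1)) = (\<Sum>s<n. real (min k' (n - 1)))" by simp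
  also have "\<dots> \<le> (\<Sum>s<n. snd (ann_query H undefined xs k' s))"
    using D(2,4) by (intro sum_mono) (meson lessThan_iff of_nat_mono order_trans)
  also have "\<dots> \<le> real n * q k k' n" using D(5)[of undefined] D(6)[of n] by linarith
  finally show ?thesis using n by simp
qed

lemma query_time_nonneg:
  assumes "ann_index H q" "1 \<le> k" "1 \<le> k'" "0 < n"
  shows "0 \<le> q k k' n"
  using query_time_ge[OF assms] by (rule order_trans[rotated]) simp

text \<open>The factor 2 arises because inserting the pairs costs one step per list entry, which the
  query time already dominates. The size of the cover is bounded twice: by n k', for upper bounds on
  time, and by the time spent, for lower bounds.\<close>

lemma
  assumes q: "ann_index H q" and k: "1 \<le> k" "1 \<le> k'" and n: "0 < state_count M"
    and len: "length xs = state_count M" and pts: "\<And>x. x \<in> set xs \<Longrightarrow> length x = k"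
  shows retrieve_time_le:
      "snd (retrieve H M z k k' xs) \<le> 2 * (real (state_count M) * q k k' (state_count M))"
    and card_retrieve_le: "card (fst (retrieve H M z k k' xs)) \<le> state_count M * k'"
    and card_retrieve_le_time: "real (card (fst (retrieve H M z k k' xs))) \<le> snd (retrieve H M z k k' xs)"
    and covers_states_retrieve: "covers_states M (fst (retrieve H M z k k' xs))"
proof -
  let ?n = "state_count M"
  define N t where "N s = fst (ann_query H z xs k' s)" and "t s = snd (ann_query H z xs k' s)" for s
  have ne: "xs \<noteq> []" using n len by auto
  note D = ann_indexD(1-5)[OF q k ne pts, unfolded len, where z = z, folded N_def t_def]
    ann_indexD(6)[OF q k ne pts]
  have time: "snd (retrieve H M z k k' xs)
      = ann_build_time H k ?n + (\<Sum>s<?n. t s + real (length (N s)))"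
    by (simp add: retrieve_def N_def t_def)
  have len_t: "(\<Sum>s<?n. real (length (N s))) \<le> (\<Sum>s<?n. t s)" using D(4) by (intro sum_mono) auto
  have t0: "0 \<le> (\<Sum>s<?n. t s)"
    using len_t by (rule order_trans[rotated]) (auto intro: sum_nonneg)
  show "snd (retrieve H M z k k' xs) \<le> 2 * (real ?n * q k k' ?n)"
    unfolding time sum.distrib using len_t t0 D(5) D(6)[of ?n] by linarith
  \<comment> \<open>Each pair is charged to a state whose query returned it, so no pair is counted
    more often than list entries exist.\<close>
  have eq: "fst (retrieve H M z k k' xs) = (\<Union>s<?n. (\<lambda>s'. {s, s'}) ` (set (N s) - {s}))"
    by (auto simp: retrieve_def N_def)
  have "card (fst (retrieve H M z k k' xs)) \<le> (\<Sum>s<?n. card ((\<lambda>s'. {s, s'}) ` (set (N s) - {s})))"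
    unfolding eq by (rule card_UN_le) simp
  also have "\<dots> \<le> (\<Sum>s<?n. length (N s))"
    by (intro sum_mono order_trans[OF card_image_le] order_trans[OF card_Diff1_le] card_length) simp
  finally have card: "card (fst (retrieve H M z k k' xs)) \<le> (\<Sum>s<?n. length (N s))" .
  also have "\<dots> \<le> (\<Sum>s<?n. k')" using D(3) by (intro sum_mono) auto
  finally show "card (fst (retrieve H M z k k' xs)) \<le> ?n * k'" by simp
  have "real (card (fst (retrieve H M z k k' xs))) \<le> (\<Sum>s<?n. real (length (N s)))"
    using card by (metis of_nat_le_iff of_nat_sum)
  then show "real (card (fst (retrieve H M z k k' xs))) \<le> snd (retrieve H M z k k' xs)"
    unfolding time sum.distrib using t0 D(6)[of ?n] by linarith
  show "covers_states M (fst (retrieve H M z k k' xs))"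
    unfolding eq covers_states_def using D(1) by fastforce
qed

lemma setup_cover_bounds:
  assumes q: "ann_index H q" and k: "1 \<le> k" "1 \<le> k'" and n: "0 < state_count M"
    and C: "C = fst (setup_cover H M ini z k k' lm)"
  shows "snd (setup_cover H M ini z k k' lm)
      \<le> snd (embed H M k lm (read_iter M ini Map.empty))
        + 2 * (real (state_count M) * q k k' (state_count M))"
    and "card C \<le> state_count M * k'" and "covers_states M C"
  unfolding C setup_cover_def bind_timed_def
  using retrieve_time_le[OF q k n embed_points] card_retrieve_le[OF q k n embed_points]
    covers_states_retrieve[OF q k n embed_points]
  by simp_all

section \<open>Cost and cover of the re-seeded rounds\<close>

text \<open>\<open>pmf_of_set\<close> has the intended support only for a finite nonempty set. Two
  states ensure that each state has another one to be paired with, so that the set of partner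
  functions is nonempty.\<close>

lemma partners_less:
  assumes w: "w \<in> set_pmf (partners M u R)" and n: "2 \<le> state_count M"
    and "r < R" "s < state_count M" "i < u"
  shows "w (r, s, i) < state_count M"
proof -
  let ?S = "PiE ({..<R} \<times> {..<state_count M} \<times> {..<u}) (\<lambda>(r, s, i). {..<state_count M} - {s})"
  have "{..<state_count M} - {s} \<noteq> {}" for s
  proof -
    have "(if s = 0 then 1 else 0) \<in> {..<state_count M} - {s}" using n by simp
    then show ?thesis by blast
  qed
  then have "?S \<noteq> {}" by (auto simp: PiE_eq_empty_iff)
  moreover have "finite ?S" by (intro finite_PiE) auto
  ultimately have "w \<in> ?S" using w unfolding partners_def by simp
  from PiE_mem[OF this, of "(r, s, i)"] show ?thesis using assms by simp
qed

lemma
  assumes q: "ann_index H q" and H: "routine_costs H" and k: "1 \<le> k" "1 \<le> k'"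
    and n: "0 < state_count M"
  shows reseed_time_le: "snd (reseed H M k k' u lms w r st)
      \<le> snd (embed H M k (lms r) (read_iter M Reward (fst st)))
        + 2 * (real (state_count M) * q k k' (state_count M)) + real (state_count M) * real u"
    and card_reseed_le: "card (fst (reseed H M k k' u lms w r st)) \<le> state_count M * (k' + u)"
    and card_reseed_le_time:
      "real (card (fst (reseed H M k k' u lms w r st))) \<le> snd (reseed H M k k' u lms w r st)"
    and covers_states_reseed:
      "(\<And>s i. s < state_count M \<Longrightarrow> i < u \<Longrightarrow> w (r, s, i) < state_count M) \<Longrightarrow>
        covers_states M (fst (reseed H M k k' u lms w r st))"
proof -
  let ?n = "state_count M"
  define e where "e = embed H M k (lms r) (read_iter M Reward (fst st))"
  define D where "D = retrieve H M r k k' (fst e)"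
  define X where "X = {{s, w (r, s, i)} |s i. s < ?n \<and> i < u}"
  have e: "length (fst e) = ?n" "\<And>x. x \<in> set (fst e) \<Longrightarrow> length x = k"
    unfolding e_def by (rule embed_points, erule embed_points)
  note D = retrieve_time_le[OF q k n e, of r, folded D_def] card_retrieve_le[OF q k n e, of r, folded D_def]
    card_retrieve_le_time[OF q k n e, of r, folded D_def] covers_states_retrieve[OF q k n e, of r, folded D_def]
  have e0: "0 \<le> snd e" unfolding e_def
    by (rule embed_time_nonneg[OF H order_trans[OF zero_le_one read_iter_time(1)]])
  have fst: "fst (reseed H M k k' u lms w r st) = fst D \<union> X"
    and snd: "snd (reseed H M k k' u lms w r st) = snd e + (snd D + real ?n * real u)"
    by (simp_all add: reseed_def bind_timed_def D_def e_def X_def)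
  have Xeq: "X = (\<lambda>(s, i). {s, w (r, s, i)}) ` ({..<?n} \<times> {..<u})" by (auto simp: X_def)
  have "card X \<le> card ({..<?n} \<times> {..<u})" unfolding Xeq by (rule card_image_le) simp
  then have X: "card X \<le> ?n * u" by simp
  have U: "card (fst D \<union> X) \<le> card (fst D) + card X" by (rule card_Un_le)
  show "snd (reseed H M k k' u lms w r st) \<le> snd (embed H M k (lms r) (read_iter M Reward (fst st)))
        + 2 * (real ?n * q k k' ?n) + real ?n * real u"
    unfolding snd using D(1) by (simp add: e_def)
  show "card (fst (reseed H M k k' u lms w r st)) \<le> ?n * (k' + u)"
    unfolding fst using U D(2) X by (simp add: algebra_simps)
  have "real (card (fst D \<union> X)) \<le> real (card (fst D)) + real ?n * real u"
    using U X by (simp only: of_nat_add[symmetric] of_nat_mult[symmetric] of_nat_le_iff)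
  then show "real (card (fst (reseed H M k k' u lms w r st))) \<le> snd (reseed H M k k' u lms w r st)"
    unfolding fst snd using D(3) e0 by linarith
  show "covers_states M (fst (reseed H M k k' u lms w r st))"
    if "\<And>s i. s < ?n \<Longrightarrow> i < u \<Longrightarrow> w (r, s, i) < ?n"
    unfolding fst using D(4) that by (intro covers_states_Un) (auto simp: covers_states_def Xeq)
qed

lemma snd_pipeline_round:
  "snd (pipeline_round H M k k' u E lms w r st) =
     snd (reseed H M k k' u lms w r st)
     + snd (sweeps H M Reward (snd (snd st) \<union> fst (reseed H M k k' u lms w r st)) E (fst st))
     + snd (sweeps H M Freeze (snd (snd st) \<union> fst (reseed H M k k' u lms w r st)) E (fst (snd st)))"
  by (simp add: pipeline_round_def bind_timed_def)

lemma pipeline_cover_Suc: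
  "snd (snd (fst (pipeline H M k k' u E lms w (Suc r)))) =
     snd (snd (fst (pipeline H M k k' u E lms w r)))
       \<union> fst (reseed H M k k' u lms w r (fst (pipeline H M k k' u E lms w r)))"
  by (simp add: pipeline_round_def bind_timed_def)

lemma pipeline_time_Suc:
  "snd (pipeline H M k k' u E lms w (Suc r)) = snd (pipeline H M k k' u E lms w r)
     + snd (pipeline_round H M k k' u E lms w r (fst (pipeline H M k k' u E lms w r)))"
  by (simp add: bind_timed_def)

lemma card_pipeline_cover_le:
  assumes "ann_index H q" "routine_costs H" "1 \<le> k" "1 \<le> k'" "0 < state_count M"
  shows "card (snd (snd (fst (pipeline H M k k' u E lms w R)))) \<le> R * (state_count M * (k' + u))"
proof (induction R)
  case (Suc R)
  have "card (snd (snd (fst (pipeline H M k k' u E lms w R)))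
      \<union> fst (reseed H M k k' u lms w R (fst (pipeline H M k k' u E lms w R))))
    \<le> R * (state_count M * (k' + u)) + state_count M * (k' + u)"
    by (rule order_trans[OF card_Un_le add_mono[OF Suc card_reseed_le[OF assms]]])
  then show ?case unfolding pipeline_cover_Suc by simp
qed simp

text \<open>The retrieval and exploration times of the rounds already account for every covered
  pair, and sweeps only add nonnegative time. A large cover thus forces much work directly, without
  a detour through the number of rounds.\<close>

lemma card_pipeline_cover_le_time:
  assumes "ann_index H q" "routine_costs H" "1 \<le> k" "1 \<le> k'" "0 < state_count M"
  shows "real (card (snd (snd (fst (pipeline H M k k' u E lms w R))))) \<le> snd (pipeline H M k k' u E lms w R)"
proof (induction R)
  case (Suc R)
  let ?P = "pipeline H M k k' u E lms w R"
  let ?D = "reseed H M k k' u lms w R (fst ?P)"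
  have "real (card (snd (snd (fst ?P)) \<union> fst ?D)) \<le> real (card (snd (snd (fst ?P)))) + real (card (fst ?D))"
    by (simp only: of_nat_add[symmetric] of_nat_le_iff card_Un_le)
  also have "\<dots> \<le> snd ?P + snd ?D"
    using Suc card_reseed_le_time[OF assms] by (rule add_mono)
  also have "\<dots> \<le> snd (pipeline H M k k' u E lms w (Suc R))"
    unfolding pipeline_time_Suc snd_pipeline_round
    using sweeps_time_nonneg[OF assms(2)] by (simp add: add_nonneg_nonneg)
  finally show ?case unfolding pipeline_cover_Suc .
qed simp

lemma covers_states_pipeline:
  assumes "ann_index H q" "routine_costs H" "1 \<le> k" "1 \<le> k'" "0 < state_count M"
    and "\<And>r s i. r < R \<Longrightarrow> s < state_count M \<Longrightarrow> i < u \<Longrightarrow> w (r, s, i) < state_count M"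
  shows "covers_states M (snd (snd (fst (pipeline H M k k' u E lms w R))))"
  using assms(6)
proof (induction R)
  case 0
  then show ?case by (simp add: covers_states_def)
next
  case (Suc R)
  then show ?case
    unfolding pipeline_cover_Suc
    by (intro covers_states_Un covers_states_reseed[OF assms(1-5)]) auto
qed

text \<open>The cover used in round \<open>r\<close> has been filled by \<open>Suc r\<close> rounds,
  hence by at most \<open>R\<close>. The factor 2 stands for the two arms. Summed over the rounds,
  this gives the term quadratic in \<open>R\<close>.\<close>

lemma pipeline_round_time_le:
  assumes q: "ann_index H q" and H: "routine_costs H" and k: "1 \<le> k" "1 \<le> k'" and M: "M \<in> mdps A m"
    and w: "\<And>r s i. r < R \<Longrightarrow> s < state_count M \<Longrightarrow> i < u \<Longrightarrow> w (r, s, i) < state_count M"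
    and r: "r < R" and st: "st = fst (pipeline H M k k' u E lms w r)"
  shows "snd (pipeline_round H M k k' u E lms w r st)
    \<le> snd (reseed H M k k' u lms w r st)
      + 2 * real E * (real R * (real (state_count M) * (real k' + real u)) * backup_cost H A m)"
proof -
  let ?n = "state_count M"
  note a = q H k mdpsD(3)[OF M]
  define C where "C = snd (snd st) \<union> fst (reseed H M k k' u lms w r st)"
  have C: "C = snd (snd (fst (pipeline H M k k' u E lms w (Suc r))))"
    unfolding pipeline_cover_Suc by (simp add: C_def st)
  have "covers_states M C" unfolding C using w r by (intro covers_states_pipeline[OF a]) auto
  note sw = sweeps_time_le[OF H M this]
  have "card C \<le> Suc r * (?n * (k' + u))" unfolding C by (rule card_pipeline_cover_le[OF a])
  also have "\<dots> \<le> R * (?n * (k' + u))" using r by (intro mult_right_mono) auto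
  finally have "real (card C) \<le> real R * (real ?n * (real k' + real u))"
    by (metis of_nat_add of_nat_le_iff of_nat_mult)
  then have "real E * (real (card C) * backup_cost H A m)
    \<le> real E * (real R * (real ?n * (real k' + real u)) * backup_cost H A m)"
    using backup_cost_ge_1[OF H, of A m] by (intro mult_left_mono mult_right_mono) auto
  then show ?thesis
    unfolding snd_pipeline_round C_def[symmetric]
    using sw[of Reward E "fst st"] sw[of Freeze E "fst (snd st)"] by linarith
qed

section \<open>Total times\<close>

lemma bigo_cmult:
  fixes f g :: "nat \<Rightarrow> real"
  shows "f \<in> O(g) \<Longrightarrow> (\<lambda>n. c * f n) \<in> O(g)"
  by (cases "c = 0") simp_all

lemma smallo_cmult:
  fixes f g :: "nat \<Rightarrow> real"
  shows "f \<in> o(g) \<Longrightarrow> (\<lambda>n. c * f n) \<in> o(g)"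
  by (cases "c = 0") simp_all

lemma backup_cost_bigo:
  assumes H: "routine_costs H"
  shows "backup_cost H A \<in> O(\<lambda>m. real m ^ 3 * ln (real m))"
proof -
  have "ot_time H \<in> O(\<lambda>N. real N ^ 3 * ln (real N))"
    using H by (simp add: routine_costs_def)
  then have "(\<lambda>m. ot_time H (2 * m)) \<in> O(\<lambda>m. real (2 * m) ^ 3 * ln (real (2 * m)))"
    by (rule landau_o.big.compose) (intro mult_nat_left_at_top, simp)
  also have "(\<lambda>m. real (2 * m) ^ 3 * ln (real (2 * m))) \<in> O(\<lambda>m. real m ^ 3 * ln (real m))"
    by real_asymp
  finally have ot: "(\<lambda>m. ot_time H (2 * m)) \<in> O(\<lambda>m. real m ^ 3 * ln (real m))" .
  have one: "(\<lambda>_. 1) \<in> O(\<lambda>m. real m ^ 3 * ln (real m))" by real_asymp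
  have sq: "(\<lambda>m. (2 * real m)\<^sup>2) \<in> O(\<lambda>m. real m ^ 3 * ln (real m))" by real_asymp
  have "(\<lambda>m. 1 + real A * (1 + (1 + real A) * (2 * real m)\<^sup>2 + ot_time H (2 * m)))
    \<in> O(\<lambda>m. real m ^ 3 * ln (real m))"
    by (intro sum_in_bigo bigo_cmult one sq ot)
  then show ?thesis by (simp add: backup_cost_def[abs_def] mult.commute)
qed

lemma setup_and_sweep_time:
  assumes H: "routine_costs H" and q: "ann_index H q"
  shows "\<exists>c>0. \<exists>e. \<forall>m k k' z ini lm. \<forall>M\<in>mdps A m. 1 \<le> k \<and> 1 \<le> k' \<and> landmarks H M k lm \<longrightarrow>
       (let n = state_count M; C = fst (setup_cover H M ini z k k' lm) in
        snd (setup_cover H M ini z k k' lm) \<le> c * (real n * (real k ^ e + q k k' n)) \<and>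
        (\<forall>t. snd (sweep H M ini C t) \<le> c * (real n * real k' * backup_cost H A m)))"
proof -
  obtain c e where c: "c > 0" and emb: "embed_bound H A c e"
    using embed_bound_exists[OF H] by blast
  have "snd (setup_cover H M ini z k k' lm)
      \<le> (c + 2) * (real (state_count M) * (real k ^ e + q k k' (state_count M))) \<and>
    snd (sweep H M ini (fst (setup_cover H M ini z k k' lm)) t)
      \<le> (c + 2) * (real (state_count M) * real k' * backup_cost H A m)"
    if M: "M \<in> mdps A m" and k: "1 \<le> k" "1 \<le> k'" and lm: "landmarks H M k lm" for m k k' z ini lm M t
  proof
    let ?n = "real (state_count M)" and ?q = "q k k' (state_count M)"
    let ?C = "fst (setup_cover H M ini z k k' lm)"
    note b = setup_cover_bounds[OF q k mdpsD(3)[OF M] refl, of ini z lm]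
    have q0: "0 \<le> ?q" by (rule query_time_nonneg[OF q k mdpsD(3)[OF M]])
    have "snd (setup_cover H M ini z k k' lm) \<le> c * (?n * real k ^ e) + 2 * (?n * ?q)"
      using b(1) embed_iter_time_le[OF emb M k(1) lm, of ini Map.empty] by linarith
    also have "\<dots> \<le> (c + 2) * (?n * real k ^ e) + (c + 2) * (?n * ?q)"
      using c q0 by (intro add_mono mult_right_mono) auto
    finally show "snd (setup_cover H M ini z k k' lm) \<le> (c + 2) * (?n * (real k ^ e + ?q))"
      by (simp add: algebra_simps)
    have bc: "1 \<le> backup_cost H A m" by (rule backup_cost_ge_1[OF H])
    have "snd (sweep H M ini ?C t) \<le> real (card ?C) * backup_cost H A m"
      by (rule sweep_time_le[OF H M b(3)])
    also have "\<dots> \<le> ?n * real k' * backup_cost H A m"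
      using b(2) bc by (intro mult_right_mono) (auto simp flip: of_nat_mult)
    also have "\<dots> \<le> (c + 2) * (?n * real k' * backup_cost H A m)"
      using c bc by (intro mult_right_mono[of 1 "c + 2", simplified]) auto
    finally show "snd (sweep H M ini ?C t) \<le> (c + 2) * (?n * real k' * backup_cost H A m)" .
  qed
  moreover have "c + 2 > 0" using c by simp
  ultimately show ?thesis unfolding Let_def by blast
qed

lemma log_gap_ge_1: "1 \<le> log_gap M ini \<epsilon>"
  by (simp add: log_gap_def)

text \<open>The lower bound 2 on the constant is recorded so that the same constant can later absorb
  the factor 2 of \<open>sweep_count_le\<close>.\<close>

lemma single_build_time:
  assumes H: "routine_costs H" and q: "ann_index H q"
  shows "\<exists>c\<ge>2. \<exists>e. \<forall>m k k' z ini lm \<epsilon>. \<forall>M\<in>mdps A m. 1 \<le> k \<and> 1 \<le> k' \<and> landmarks H M k lm \<longrightarrow>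
       (let n = state_count M in
        snd (single_build H M ini z k k' lm (sweep_count M ini \<epsilon>))
          \<le> c * (real n * (real k ^ e + q k k' n)
          + real n * real k' * backup_cost H A m / (1 - disc M) * log_gap M ini \<epsilon>))"
proof -
  obtain c e where c: "c > 0" and build: "\<And>m k k' z ini lm M. M \<in> mdps A m \<Longrightarrow> 1 \<le> k \<Longrightarrow> 1 \<le> k' \<Longrightarrow>
      landmarks H M k lm \<Longrightarrow> snd (setup_cover H M ini z k k' lm)
        \<le> c * (real (state_count M) * (real k ^ e + q k k' (state_count M)))"
    using setup_and_sweep_time[OF H q, of A] unfolding Let_def by blast
  have "snd (single_build H M ini z k k' lm (sweep_count M ini \<epsilon>))
      \<le> (c + 2) * (real (state_count M) * (real k ^ e + q k k' (state_count M))
          + real (state_count M) * real k' * backup_cost H A m / (1 - disc M) * log_gap M ini \<epsilon>)"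
    if M: "M \<in> mdps A m" and k: "1 \<le> k" "1 \<le> k'" and lm: "landmarks H M k lm" for m k k' z ini lm M \<epsilon>
  proof -
    let ?n = "real (state_count M)" and ?q = "q k k' (state_count M)" and ?K = "sweep_count M ini \<epsilon>"
    define C where "C = fst (setup_cover H M ini z k k' lm)"
    define g where "g = log_gap M ini \<epsilon> / (1 - disc M)"
    define W where "W = ?n * real k' * backup_cost H A m"
    note b = setup_cover_bounds[OF q k mdpsD(3)[OF M] C_def]
    have q0: "0 \<le> ?q" by (rule query_time_nonneg[OF q k mdpsD(3)[OF M]])
    have bc: "1 \<le> backup_cost H A m" by (rule backup_cost_ge_1[OF H])
    have W: "real (card C) * backup_cost H A m \<le> W" "0 \<le> W"
      using b(2) bc unfolding W_def by (auto intro!: mult_right_mono simp flip: of_nat_mult)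
    have g: "real ?K \<le> 2 * g" "0 \<le> g"
      using sweep_count_le[OF mdpsD(1)[OF M], of ini \<epsilon>] mdpsD(1)[OF M] log_gap_ge_1[of M ini \<epsilon>]
      unfolding g_def mdp_wf_def by auto
    have "snd (sweeps H M ini C ?K Map.empty) \<le> real ?K * (real (card C) * backup_cost H A m)"
      by (rule sweeps_time_le[OF H M b(3)])
    also have "\<dots> \<le> (2 * g) * W" using W g bc by (intro mult_mono) auto
    also have "\<dots> = 2 * (W * g)" by simp
    also have "\<dots> \<le> (c + 2) * (W * g)"
      using c by (intro mult_right_mono mult_nonneg_nonneg W(2) g(2)) simp
    finally have "snd (sweeps H M ini C ?K Map.empty) \<le> (c + 2) * (W * g)" .
    moreover have "snd (setup_cover H M ini z k k' lm) \<le> (c + 2) * (?n * (real k ^ e + ?q))"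
      using q0 by (intro order_trans[OF build[OF M k lm]] mult_right_mono) auto
    ultimately have "snd (single_build H M ini z k k' lm ?K)
        \<le> (c + 2) * (?n * (real k ^ e + ?q)) + (c + 2) * (W * g)"
      by (simp add: single_build_def bind_timed_def C_def)
    then show ?thesis by (simp add: W_def g_def distrib_left)
  qed
  moreover have "c + 2 \<ge> 2" using c by simp
  ultimately show ?thesis unfolding Let_def by blast
qed

lemma single_build_accuracy_and_time:
  assumes H: "routine_costs H" and q: "ann_index H q"
  shows "\<exists>c>0. \<exists>e. \<forall>m k k' z ini lm \<epsilon>. \<forall>M\<in>mdps A m.
       1 \<le> k \<and> 1 \<le> k' \<and> landmarks H M k lm \<and> 0 < \<epsilon> \<longrightarrow>
       (let n = state_count M; K = sweep_count M ini \<epsilon>;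
            run = single_build H M ini z k k' lm K in
        real K \<le> c * (log_gap M ini \<epsilon> / (1 - disc M)) \<and>
        covered_error M (snd (fst run)) (fst (fst run))
          \<le> disc M * coverage_floor M ini (snd (fst run)) + \<epsilon> \<and>
        snd run \<le> c * (real n * (real k ^ e + q k k' n)
          + real n * real k' * backup_cost H A m / (1 - disc M) * log_gap M ini \<epsilon>))"
proof -
  obtain c e where c: "c \<ge> 2" and T: "\<And>m k k' z ini lm \<epsilon> M. M \<in> mdps A m \<Longrightarrow> 1 \<le> k \<Longrightarrow> 1 \<le> k' \<Longrightarrow>
      landmarks H M k lm \<Longrightarrow> snd (single_build H M ini z k k' lm (sweep_count M ini \<epsilon>))
          \<le> c * (real (state_count M) * (real k ^ e + q k k' (state_count M))
          + real (state_count M) * real k' * backup_cost H A m / (1 - disc M) * log_gap M ini \<epsilon>)"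
    using single_build_time[OF H q, of A] unfolding Let_def by blast
  have K: "real (sweep_count M ini \<epsilon>) \<le> c * (log_gap M ini \<epsilon> / (1 - disc M))"
    if "mdp_wf M" for M ini \<epsilon>
  proof -
    have "0 \<le> log_gap M ini \<epsilon> / (1 - disc M)"
      using log_gap_ge_1[of M ini \<epsilon>] that by (simp add: mdp_wf_def)
    then show ?thesis using sweep_count_le[OF that] c by (meson mult_right_mono order_trans)
  qed
  have acc: "covered_error M (snd (fst (single_build H M ini z k k' lm (sweep_count M ini \<epsilon>))))
        (fst (fst (single_build H M ini z k k' lm (sweep_count M ini \<epsilon>))))
      \<le> disc M * coverage_floor M ini (snd (fst (single_build H M ini z k k' lm (sweep_count M ini \<epsilon>)))) + \<epsilon>"
    if "mdp_wf M" "0 < \<epsilon>" for M ini z k k' lm \<epsilon>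
    using single_build_accuracy[OF that refl] by (simp add: single_build_def bind_timed_def)
  show ?thesis
    unfolding Let_def
    by (intro exI[of _ c] conjI exI[of _ e] allI ballI impI K acc T)
      (use c in \<open>auto dest: mdpsD(1)\<close>)
qed

section \<open>Simplified bounds for concrete query times\<close>

text \<open>An O-bound speaks only of large n, whereas the simplified time bounds range over MDPs of
  every size. Since \<open>g\<close> is at least 1, a larger constant takes care of the finitely
  many exceptions.\<close>

lemma bigo_bound_from_1:
  fixes f g :: "nat \<Rightarrow> real"
  assumes "f \<in> O(g)" and g: "\<And>n. 1 \<le> n \<Longrightarrow> 1 \<le> g n"
  shows "\<exists>C\<ge>0. \<forall>n\<ge>1. f n \<le> C * g n"
proof -
  obtain c N where N: "\<And>n. N \<le> n \<Longrightarrow> norm (f n) \<le> c * norm (g n)"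
    using landau_o.bigE[OF assms(1)] unfolding eventually_at_top_linorder by blast
  \<comment> \<open>The sum of the finitely many early values dominates each of them.\<close>
  define C where "C = \<bar>c\<bar> + (\<Sum>n<N. \<bar>f n\<bar>)"
  have "f n \<le> C * g n" if n: "1 \<le> n" for n
  proof (cases "N \<le> n")
    case True
    have "f n \<le> c * g n" using N[OF True] g[OF n] by simp
    also have "\<dots> \<le> C * g n"
      using g[OF n] unfolding C_def by (intro mult_right_mono) (auto intro: add_increasing2 sum_nonneg)
    finally show ?thesis .
  next
    case False
    then have "\<bar>f n\<bar> \<le> (\<Sum>n<N. \<bar>f n\<bar>)" by (intro member_le_sum) auto
    also have "\<dots> \<le> C" by (simp add: C_def)
    finally have "\<bar>f n\<bar> \<le> C" .
    then have "f n \<le> C * 1" by simp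
    also have "\<dots> \<le> C * g n" using g[OF n] \<open>\<bar>f n\<bar> \<le> C\<close> by (intro mult_left_mono) auto
    finally show ?thesis .
  qed
  moreover have "0 \<le> C" unfolding C_def by (simp add: sum_nonneg)
  ultimately show ?thesis by blast
qed

text \<open>With a nonnegative exponent the power of n is at least 1, so the embedding term is
  absorbed by it. The factor \<open>log_gap\<close> is at least 1 and may be put on the setup term
  too, whereas 1/(1 - gamma) stays on the sweeps alone.\<close>

lemma single_build_time_lsh:
  assumes H: "routine_costs H" and q: "ann_index H q"
    and k: "1 \<le> k" "1 \<le> k'" and \<rho>: "0 \<le> \<rho>" and qO: "q k k' \<in> O(\<lambda>n. real n powr \<rho>)"
  shows "\<exists>c. \<forall>z ini lm \<epsilon>. \<forall>M\<in>mdps A m. landmarks H M k lm \<longrightarrow>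
      snd (single_build H M ini z k k' lm (sweep_count M ini \<epsilon>))
        \<le> c * (real (state_count M) powr (1 + \<rho>) + real (state_count M) / (1 - disc M)) * log_gap M ini \<epsilon>"
proof -
  obtain c e where c: "c \<ge> 2" and T: "\<And>m k k' z ini lm \<epsilon> M. M \<in> mdps A m \<Longrightarrow> 1 \<le> k \<Longrightarrow> 1 \<le> k' \<Longrightarrow>
      landmarks H M k lm \<Longrightarrow> snd (single_build H M ini z k k' lm (sweep_count M ini \<epsilon>))
          \<le> c * (real (state_count M) * (real k ^ e + q k k' (state_count M))
          + real (state_count M) * real k' * backup_cost H A m / (1 - disc M) * log_gap M ini \<epsilon>)"
    using single_build_time[OF H q, of A] unfolding Let_def by blast
  obtain C where C: "0 \<le> C" "\<And>n. 1 \<le> n \<Longrightarrow> q k k' n \<le> C * real n powr \<rho>"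
    using bigo_bound_from_1[OF qO] \<rho> ge_one_powr_ge_zero by force
  define B where "B = real k ^ e + C + real k' * backup_cost H A m"
  have "snd (single_build H M ini z k k' lm (sweep_count M ini \<epsilon>))
      \<le> (c * B) * (real (state_count M) powr (1 + \<rho>) + real (state_count M) / (1 - disc M)) * log_gap M ini \<epsilon>"
    if M: "M \<in> mdps A m" and lm: "landmarks H M k lm" for z ini lm \<epsilon> M
  proof -
    define n g X Y where "n = real (state_count M)" and "g = log_gap M ini \<epsilon>"
      and "X = n powr (1 + \<rho>)" and "Y = n / (1 - disc M)"
    have n: "1 \<le> n" using mdpsD(3)[OF M] by (simp add: n_def)
    have g: "1 \<le> g" unfolding g_def by (rule log_gap_ge_1)
    have p: "1 \<le> n powr \<rho>" using n \<rho> by (simp add: ge_one_powr_ge_zero)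
    have X: "X = n * n powr \<rho>" using n by (simp add: X_def powr_add)
    have Y: "0 \<le> Y" using n mdpsD(1)[OF M] by (simp add: Y_def mdp_wf_def)
    have bc: "1 \<le> backup_cost H A m" by (rule backup_cost_ge_1[OF H])
    have X0: "0 \<le> X" by (simp add: X_def)
    have "real k ^ e + q k k' (state_count M) \<le> real k ^ e * n powr \<rho> + C * n powr \<rho>"
      using C(2)[of "state_count M"] n p
      by (intro add_mono) (auto simp: n_def mult_le_cancel_left1)
    then have "n * (real k ^ e + q k k' (state_count M)) \<le> n * ((real k ^ e + C) * n powr \<rho>)"
      using n by (intro mult_left_mono) (auto simp: algebra_simps)
    also have "\<dots> = (real k ^ e + C) * X" by (simp add: X)
    also have "\<dots> \<le> B * X" using bc X0 unfolding B_def by (intro mult_right_mono) auto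
    also have "\<dots> \<le> B * X * g" using bc X0 g C(1) unfolding B_def
      by (intro mult_left_mono[of 1 g, simplified]) auto
    finally have 1: "n * (real k ^ e + q k k' (state_count M)) \<le> B * X * g" .
    have "n * real k' * backup_cost H A m / (1 - disc M) * g = (real k' * backup_cost H A m) * (Y * g)"
      by (simp add: Y_def)
    also have "\<dots> \<le> B * (Y * g)"
      using Y g C(1) unfolding B_def by (intro mult_right_mono) auto
    finally have 2: "n * real k' * backup_cost H A m / (1 - disc M) * g \<le> B * (Y * g)" .
    have "snd (single_build H M ini z k k' lm (sweep_count M ini \<epsilon>)) \<le> c * (B * X * g + B * (Y * g))"
      using c 1 2 by (intro order_trans[OF T[OF M k lm]] mult_left_mono add_mono) (auto simp: n_def g_def)
    also have "\<dots> = (c * B) * (X + Y) * g" by (simp add: algebra_simps)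
    finally show ?thesis unfolding X_def Y_def n_def g_def .
  qed
  then show ?thesis by blast
qed

text \<open>Multiplying the setup by \<open>log_gap\<close> over 1 - gamma, which is at least 1,
  isolates a factor that depends on n alone. This is the right shape for polylogarithmic queries and
  for the sub-quadratic claim, but too coarse for the hashing bound, whose setup term carries no
  1/(1 - gamma).\<close>

lemma single_build_time_scaled:
  assumes H: "routine_costs H" and q: "ann_index H q" and k: "1 \<le> k" "1 \<le> k'"
  shows "\<exists>c\<ge>2. \<exists>e. \<forall>z ini lm \<epsilon>. \<forall>M\<in>mdps A m. landmarks H M k lm \<longrightarrow>
       (let n = state_count M in
        snd (single_build H M ini z k k' lm (sweep_count M ini \<epsilon>))
          \<le> c * (real n * (real k ^ e + q k k' n + real k' * backup_cost H A m))
              * (log_gap M ini \<epsilon> / (1 - disc M)))"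
proof -
  obtain c e where c: "c \<ge> 2" and T: "\<And>m k k' z ini lm \<epsilon> M. M \<in> mdps A m \<Longrightarrow> 1 \<le> k \<Longrightarrow> 1 \<le> k' \<Longrightarrow>
      landmarks H M k lm \<Longrightarrow> snd (single_build H M ini z k k' lm (sweep_count M ini \<epsilon>))
          \<le> c * (real (state_count M) * (real k ^ e + q k k' (state_count M))
          + real (state_count M) * real k' * backup_cost H A m / (1 - disc M) * log_gap M ini \<epsilon>)"
    using single_build_time[OF H q, of A] unfolding Let_def by blast
  have "snd (single_build H M ini z k k' lm (sweep_count M ini \<epsilon>))
      \<le> c * (real (state_count M) * (real k ^ e + q k k' (state_count M) + real k' * backup_cost H A m))
              * (log_gap M ini \<epsilon> / (1 - disc M))"
    if M: "M \<in> mdps A m" and lm: "landmarks H M k lm" for z ini lm \<epsilon> M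
  proof -
    define n Q g where "n = real (state_count M)" and "Q = real k ^ e + q k k' (state_count M)"
      and "g = log_gap M ini \<epsilon> / (1 - disc M)"
    have \<gamma>: "0 \<le> disc M" "disc M < 1" using mdpsD(1)[OF M] by (auto simp: mdp_wf_def)
    have g: "1 \<le> g" using log_gap_ge_1[of M ini \<epsilon>] \<gamma> by (simp add: g_def le_divide_eq)
    have "0 \<le> Q" using query_time_nonneg[OF q k mdpsD(3)[OF M]] by (simp add: Q_def)
    then have "n * Q * 1 \<le> n * Q * g" using g by (intro mult_left_mono) (auto simp: n_def)
    then have "n * Q + n * real k' * backup_cost H A m * g
        \<le> n * Q * g + n * real k' * backup_cost H A m * g"
      by simp
    then have "c * (n * Q + n * real k' * backup_cost H A m * g)
        \<le> c * (n * Q * g + n * real k' * backup_cost H A m * g)"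
      using c by (intro mult_left_mono) auto
    with T[OF M k lm, of ini z \<epsilon>] show ?thesis
      unfolding n_def[symmetric] Q_def[symmetric] g_def[symmetric]
      by (simp add: g_def algebra_simps)
  qed
  with c show ?thesis unfolding Let_def by blast
qed

lemma single_build_time_polylog:
  assumes H: "routine_costs H" and q: "ann_index H q"
    and k: "1 \<le> k" "1 \<le> k'" and qO: "q k k' \<in> O(\<lambda>n. ln (real n) ^ i)"
  shows "\<exists>c. \<forall>z ini lm \<epsilon>. \<forall>M\<in>mdps A m. landmarks H M k lm \<longrightarrow>
      snd (single_build H M ini z k k' lm (sweep_count M ini \<epsilon>))
        \<le> c * (real (state_count M) / (1 - disc M))
            * (max 1 (ln (real (state_count M))) ^ i * log_gap M ini \<epsilon>)"
proof -
  obtain c e where c: "c \<ge> 2" and T: "\<And>z ini lm \<epsilon> M. M \<in> mdps A m \<Longrightarrow>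
      landmarks H M k lm \<Longrightarrow> snd (single_build H M ini z k k' lm (sweep_count M ini \<epsilon>))
          \<le> c * (real (state_count M) * (real k ^ e + q k k' (state_count M) + real k' * backup_cost H A m))
              * (log_gap M ini \<epsilon> / (1 - disc M))"
    using single_build_time_scaled[OF H q k, of A m] unfolding Let_def by blast
  \<comment> \<open>The logarithm is raised to at least 1 because it vanishes at n = 1, while
    \<open>bigo_bound_from_1\<close> asks for a comparison function bounded below by 1.\<close>
  have "(\<lambda>n. ln (real n) ^ i) \<in> O(\<lambda>n. max 1 (ln (real n)) ^ i)"
  proof (rule landau_o.big_mono, rule eventually_mono[OF eventually_ge_at_top[of 1]])
    fix n :: nat assume "1 \<le> n"
    then show "norm (ln (real n) ^ i) \<le> norm (max 1 (ln (real n)) ^ i)"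
      by (auto simp: norm_power intro!: power_mono)
  qed
  with qO have "q k k' \<in> O(\<lambda>n. max 1 (ln (real n)) ^ i)"
    by (rule landau_o.big_trans)
  from bigo_bound_from_1[OF this] obtain C
    where C: "0 \<le> C" "\<And>n. 1 \<le> n \<Longrightarrow> q k k' n \<le> C * max 1 (ln (real n)) ^ i"
    by auto
  define B where "B = real k ^ e + C + real k' * backup_cost H A m"
  have "snd (single_build H M ini z k k' lm (sweep_count M ini \<epsilon>))
      \<le> (c * B) * (real (state_count M) / (1 - disc M))
            * (max 1 (ln (real (state_count M))) ^ i * log_gap M ini \<epsilon>)"
    if M: "M \<in> mdps A m" and lm: "landmarks H M k lm" for z ini lm \<epsilon> M
  proof -
    define n g P where "n = real (state_count M)" and "g = log_gap M ini \<epsilon> / (1 - disc M)"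
      and "P = max 1 (ln (real (state_count M))) ^ i"
    have g: "0 \<le> g" using log_gap_ge_1[of M ini \<epsilon>] mdpsD(1)[OF M] by (simp add: g_def mdp_wf_def)
    have P: "1 \<le> P" by (simp add: P_def)
    have bc: "1 \<le> backup_cost H A m" by (rule backup_cost_ge_1[OF H])
    have "real k ^ e + q k k' (state_count M) + real k' * backup_cost H A m
      \<le> real k ^ e * P + C * P + (real k' * backup_cost H A m) * P"
      using C(2)[of "state_count M"] mdpsD(3)[OF M] P bc
      by (intro add_mono mult_left_mono[of 1 P, simplified]) (auto simp: P_def)
    also have "\<dots> = B * P" by (simp add: B_def algebra_simps)
    finally have "c * (n * (real k ^ e + q k k' (state_count M) + real k' * backup_cost H A m)) * g
      \<le> c * (n * (B * P)) * g"
      using c g by (intro mult_right_mono mult_left_mono) (auto simp: n_def)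
    also have "\<dots> = (c * B) * (n / (1 - disc M)) * (P * log_gap M ini \<epsilon>)"
      by (simp add: g_def)
    finally show ?thesis using T[OF M lm, of ini z \<epsilon>] unfolding n_def P_def g_def by linarith
  qed
  then show ?thesis by blast
qed

text \<open>Both kinds of query time are used only through q = o(n). The accuracy factor depends on
  the instance and therefore stays outside the function \<open>g\<close> of n.\<close>

lemma single_build_subquadratic:
  assumes H: "routine_costs H" and q: "ann_index H q" and k: "1 \<le> k" "1 \<le> k'"
    and qO: "(\<exists>\<rho><1. q k k' \<in> O(\<lambda>n. real n powr \<rho>)) \<or> (\<exists>i. q k k' \<in> O(\<lambda>n. ln (real n) ^ i))"
  shows "\<exists>g :: nat \<Rightarrow> real. g \<in> o(\<lambda>n. real n ^ 2) \<and>
         (\<forall>z ini lm \<epsilon>. \<forall>M\<in>mdps A m. landmarks H M k lm \<longrightarrow>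
            snd (single_build H M ini z k k' lm (sweep_count M ini \<epsilon>))
              \<le> g (state_count M) * (log_gap M ini \<epsilon> / (1 - disc M)))"
proof -
  obtain c e where T: "\<And>z ini lm \<epsilon> M. M \<in> mdps A m \<Longrightarrow>
      landmarks H M k lm \<Longrightarrow> snd (single_build H M ini z k k' lm (sweep_count M ini \<epsilon>))
          \<le> c * (real (state_count M) * (real k ^ e + q k k' (state_count M) + real k' * backup_cost H A m))
              * (log_gap M ini \<epsilon> / (1 - disc M))"
    using single_build_time_scaled[OF H q k, of A m] unfolding Let_def by blast
  have "q k k' \<in> o(\<lambda>n. real n)"
    using qO
  proof
    assume "\<exists>\<rho><1. q k k' \<in> O(\<lambda>n. real n powr \<rho>)"
    then obtain \<rho> where "\<rho> < 1" "q k k' \<in> O(\<lambda>n. real n powr \<rho>)" by blast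
    moreover have "(\<lambda>n. real n powr \<rho>) \<in> o(\<lambda>n. real n)" using \<open>\<rho> < 1\<close> by real_asymp
    ultimately show ?thesis using landau_o.big_small_trans by blast
  next
    assume "\<exists>i. q k k' \<in> O(\<lambda>n. ln (real n) ^ i)"
    then obtain i where "q k k' \<in> O(\<lambda>n. ln (real n) ^ i)" by blast
    moreover have "(\<lambda>n. ln (real n) ^ i) \<in> o(\<lambda>n. real n)" by real_asymp
    ultimately show ?thesis using landau_o.big_small_trans by blast
  qed
  moreover have "(\<lambda>n. real k ^ e + real k' * backup_cost H A m) \<in> o(\<lambda>n. real n)" by real_asymp
  ultimately have "(\<lambda>n. q k k' n + (real k ^ e + real k' * backup_cost H A m)) \<in> o(\<lambda>n. real n)"
    by (rule sum_in_smallo)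
  then have "(\<lambda>n. real n * (q k k' n + (real k ^ e + real k' * backup_cost H A m))) \<in> o(\<lambda>n. real n * real n)"
    by (rule landau_o.small.mult_left)
  then have "(\<lambda>n. c * (real n * (q k k' n + (real k ^ e + real k' * backup_cost H A m)))) \<in> o(\<lambda>n. real n * real n)"
    by (rule smallo_cmult)
  then have "(\<lambda>n. c * (real n * (real k ^ e + q k k' n + real k' * backup_cost H A m))) \<in> o(\<lambda>n. real n ^ 2)"
    by (simp add: power2_eq_square add_ac)
  with T show ?thesis
    by (intro exI[of _ "\<lambda>n. c * (real n * (real k ^ e + q k k' n + real k' * backup_cost H A m))"]) auto
qed

section \<open>One sweep over all pairs\<close>

lemma fst_full_sweep: "fst (full_sweep H M f) = bisim_op M f"
  by (simp add: full_sweep_def bisim_op_def backup_def transport_def Let_def fun_eq_iff)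

lemma snd_full_sweep:
  "snd (full_sweep H M f) =
     (\<Sum>(s, s')\<in>{(s, s'). s < s' \<and> s' < state_count M}. snd (backup H M (\<lambda>x y. (f x y, 1)) s s'))"
  by (simp add: full_sweep_def Let_def)

lemma full_sweep_time_le:
  assumes H: "routine_costs H" and M: "M \<in> mdps A m"
  shows "snd (full_sweep H M f) \<le> real (state_count M) ^ 2 * backup_cost H A m"
proof -
  let ?n = "state_count M" and ?S = "{(s, s'). s < s' \<and> s' < state_count M}"
  have sub: "?S \<subseteq> {..<?n} \<times> {..<?n}" by auto
  have "card ?S \<le> card ({..<?n} \<times> {..<?n})" by (intro card_mono sub) simp
  then have card: "card ?S \<le> ?n ^ 2" by (simp add: power2_eq_square)
  have bc: "1 \<le> backup_cost H A m" by (rule backup_cost_ge_1[OF H])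
  have "snd (backup H M (\<lambda>x y. (f x y, 1)) s s') \<le> backup_cost H A m" if "s < s'" "s' < ?n" for s s'
  proof -
    have "snd (backup H M (\<lambda>x y. (f x y, 1)) s s')
      \<le> 1 + real A * (1 + (2 * real m)\<^sup>2 * (1 + real A) + ot_time H (2 * m))"
      using that by (intro backup_time_le[OF H M]) auto
    then show ?thesis by (simp add: backup_cost_def)
  qed
  then have "snd (full_sweep H M f) \<le> real (card ?S) * backup_cost H A m"
    unfolding snd_full_sweep by (intro sum_bounded_above) auto
  also have "\<dots> \<le> real (?n ^ 2) * backup_cost H A m"
    using card bc by (intro mult_right_mono of_nat_mono) auto
  finally show ?thesis by simp
qed

text \<open>Only pairs with one state in each half are counted. They are already quadratically many,
  and they are the pairs whose transport problems can all be made large at once.\<close>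

lemma full_sweep_time_ge:
  assumes H: "routine_costs H" and n: "2 \<le> state_count M" and "0 \<le> b"
    and b: "\<And>s s'. s < state_count M div 2 \<Longrightarrow> state_count M div 2 \<le> s' \<Longrightarrow> s' < state_count M \<Longrightarrow>
      b \<le> snd (backup H M (\<lambda>x y. (f x y, 1)) s s')"
  shows "real (state_count M) ^ 2 / 8 * b \<le> snd (full_sweep H M f)"
proof -
  define n h where "n = state_count M" and "h = state_count M div 2"
  let ?S = "{(s, s'). s < s' \<and> s' < state_count M}" and ?T = "{..<h} \<times> {h..<n}"
  \<comment> \<open>The factor 3 is attained at n = 3, where the lower half has one state. The
    product 6 is rounded up to 8.\<close>
  have "n \<le> 3 * h" "n \<le> 2 * (n - h)" using n unfolding n_def h_def by linarith+
  then have "n * n \<le> (3 * h) * (2 * (n - h))" by (rule mult_mono) auto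
  also have "\<dots> \<le> 8 * card ?T" by simp
  finally have "n * n \<le> 8 * card ?T" .
  then have "real (n * n) \<le> real (8 * card ?T)" by (rule of_nat_mono)
  then have card: "real n ^ 2 / 8 \<le> real (card ?T)" by (simp add: power2_eq_square)
  have fin: "finite ?S"
    by (rule finite_subset[of _ "{..<state_count M} \<times> {..<state_count M}"]) auto
  have "real n ^ 2 / 8 * b \<le> real (card ?T) * b"
    using card \<open>0 \<le> b\<close> by (rule mult_right_mono)
  also have "\<dots> \<le> (\<Sum>(s, s')\<in>?T. snd (backup H M (\<lambda>x y. (f x y, 1)) s s'))"
    by (rule sum_bounded_below) (use b in \<open>auto simp: h_def n_def\<close>)
  also have "\<dots> \<le> snd (full_sweep H M f)"
    unfolding snd_full_sweep
    by (rule sum_mono2[OF fin]) (use n in \<open>auto simp: h_def n_def intro: order_trans[OF zero_le_one backup_time_ge_1[OF H]]\<close>)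
  finally show ?thesis by (simp add: n_def)
qed

text \<open>An instance may have far smaller supports than \<open>m\<close> permits, so the constant
  has to depend on \<open>m\<close>; one step per backup is then enough.\<close>

lemma full_sweep_time_ge_fixed:
  assumes H: "routine_costs H"
  shows "\<exists>c>0. \<forall>M\<in>mdps A m. \<forall>f. 2 \<le> state_count M \<longrightarrow>
        c * (real (state_count M) ^ 2 * backup_cost H A m) \<le> snd (full_sweep H M f)"
proof -
  have bc: "1 \<le> backup_cost H A m" by (rule backup_cost_ge_1[OF H])
  have "1 / (8 * backup_cost H A m) * (real (state_count M) ^ 2 * backup_cost H A m)
      \<le> snd (full_sweep H M f)" if "2 \<le> state_count M" for M f
  proof -
    have "real (state_count M) ^ 2 / 8 * 1 \<le> snd (full_sweep H M f)"
      by (intro full_sweep_time_ge[OF H that] backup_time_ge_1[OF H]) auto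
    then show ?thesis using bc by (simp add: field_simps)
  qed
  then show ?thesis using bc by (intro exI[of _ "1 / (8 * backup_cost H A m)"]) auto
qed

text \<open>Half of the states move uniformly on one block of \<open>m\<close> states, the other half on a disjoint block,
  so every pair across the halves has a transport problem on \<open>2 m\<close> points.\<close>

lemma full_sweep_time_ge_uniform:
  assumes H: "routine_costs H" and A: "0 < A"
  shows "\<exists>c>0. \<forall>m\<ge>1. \<forall>n\<ge>2 * m. \<exists>M\<in>mdps A m. state_count M = n \<and>
        (\<forall>f. c * (real n ^ 2 * backup_cost H A m) \<le> snd (full_sweep H M f))"
proof -
  \<comment> \<open>The 8 comes from counting the pairs; 1 + A bridges the array reads of a full
    sweep, one step each, and the 1 + A steps that \<open>backup_cost\<close> charges per
    read.\<close>
  define c where "c = 1 / (8 * (1 + real A))"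
  have "\<exists>M\<in>mdps A m. state_count M = n \<and>
        (\<forall>f. c * (real n ^ 2 * backup_cost H A m) \<le> snd (full_sweep H M f))"
    if m: "1 \<le> m" and n: "2 * m \<le> n" for m n
  proof -
    define supp where "supp s = (if s < n div 2 then {..<m} else {m..<2 * m})" for s
    define M where "M = \<lparr>state_count = n, action_count = A, kern = (\<lambda>s a. pmf_of_set (supp s)),
      rew = (\<lambda>s a. 0), rmax = 0, disc = 0\<rparr>"
    have supp: "finite (supp s)" "supp s \<noteq> {}" "card (supp s) = m" "supp s \<subseteq> {..<n}" for s
      using m n by (auto simp: supp_def lessThan_empty_iff)
    have set: "set_pmf (kern M s a) = supp s" for s a
      by (simp add: M_def supp)
    have cnt: "state_count M = n" "action_count M = A" by (simp_all add: M_def)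
    have M: "M \<in> mdps A m"
      unfolding mdps_def mdp_wf_def mem_Collect_eq set cnt
      using supp A m n by (auto simp: M_def)
    define b where "b = 1 + real A * (1 + (2 * real m)\<^sup>2 + ot_time H (2 * m))"
    have ot: "0 \<le> ot_time H (2 * m)" by (rule routine_costs_ot(2)[OF H])
    have b0: "0 \<le> b" unfolding b_def using ot by simp
    have "(2 * real m)\<^sup>2 * (1 + real A) + (1 + ot_time H (2 * m))
      \<le> (2 * real m)\<^sup>2 * (1 + real A) + (1 + ot_time H (2 * m)) * (1 + real A)"
      using ot by (intro add_left_mono) (simp add: mult_le_cancel_left1)
    then have "real A * (1 + (2 * real m)\<^sup>2 * (1 + real A) + ot_time H (2 * m))
      \<le> real A * ((1 + (2 * real m)\<^sup>2 + ot_time H (2 * m)) * (1 + real A))"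
      by (intro mult_left_mono) (simp_all add: algebra_simps)
    then have bc: "backup_cost H A m \<le> (1 + real A) * b"
      unfolding backup_cost_def b_def by (simp add: algebra_simps)
    have "c * (real n ^ 2 * backup_cost H A m) \<le> snd (full_sweep H M f)" for f
    proof -
      have "c * (real n ^ 2 * backup_cost H A m) \<le> c * (real n ^ 2 * ((1 + real A) * b))"
        using bc by (intro mult_left_mono) (auto simp: c_def)
      also have "\<dots> = real n ^ 2 / 8 * b" unfolding c_def by (simp add: field_simps)
      also have "\<dots> \<le> snd (full_sweep H M f)"
        unfolding cnt(1)[symmetric]
      proof (rule full_sweep_time_ge[OF H _ b0], unfold cnt)
        show "2 \<le> n" using m n by linarith
        fix s s' assume s: "s < n div 2" "n div 2 \<le> s'" "s' < n"
        then have "supp s \<union> supp s' = {..<2 * m}" by (auto simp: supp_def)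
        then have "snd (transport H (\<lambda>x y. (f x y, 1)) (kern M s a) (kern M s' a))
            = (2 * real m)\<^sup>2 + ot_time H (2 * m)" for a
          by (simp add: transport_def Let_def set power2_eq_square)
        then show "b \<le> snd (backup H M (\<lambda>x y. (f x y, 1)) s s')"
          by (simp add: backup_def cnt b_def add.assoc)
      qed
      finally show ?thesis .
    qed
    then show ?thesis using M cnt by blast
  qed
  moreover have "c > 0" by (simp add: c_def)
  ultimately show ?thesis by blast
qed

section \<open>The re-seeded pipeline\<close>

text \<open>Reduces an almost-sure claim to a deterministic one about partners that are
  states.\<close>

lemma AE_partners:
  assumes "2 \<le> state_count M"
    and "\<And>w. (\<And>r s i. r < R \<Longrightarrow> s < state_count M \<Longrightarrow> i < u \<Longrightarrow> w (r, s, i) < state_count M) \<Longrightarrow> P w"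
  shows "AE w in measure_pmf (partners M u R). P w"
  using assms partners_less by (auto simp: AE_measure_pmf_iff)

lemma pipeline_time_decomp:
  "snd (pipeline H M k k' u E lms w R)
    = (\<Sum>r<R. snd (pipeline_round H M k k' u E lms w r (fst (pipeline H M k k' u E lms w r))))"
proof (induction R)
  case (Suc R)
  then show ?case unfolding pipeline_time_Suc by simp
qed simp

lemma
  assumes H: "routine_costs H" and q: "ann_index H q" and emb: "embed_bound H A c e"
    and M: "M \<in> mdps A m" and k: "1 \<le> k" "1 \<le> k'" and lm: "\<forall>r. landmarks H M k (lms r)"
  shows reseed_time_bound: "snd (reseed H M k k' u lms w r st)
      \<le> c * (real (state_count M) * real k ^ e) + 2 * (real (state_count M) * q k k' (state_count M))
        + real (state_count M) * real u"
    and pipeline_round_time_bound: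
      "(\<And>r s i. r < R \<Longrightarrow> s < state_count M \<Longrightarrow> i < u \<Longrightarrow> w (r, s, i) < state_count M) \<Longrightarrow> r < R \<Longrightarrow>
        snd (pipeline_round H M k k' u E lms w r (fst (pipeline H M k k' u E lms w r)))
        \<le> c * (real (state_count M) * real k ^ e) + 2 * (real (state_count M) * q k k' (state_count M))
        + real (state_count M) * real u
          + 2 * real E * (real R * (real (state_count M) * (real k' + real u)) * backup_cost H A m)"
proof -
  have seed: "snd (reseed H M k k' u lms w r st) \<le> c * (real (state_count M) * real k ^ e) + 2 * (real (state_count M) * q k k' (state_count M))
        + real (state_count M) * real u" for st
    using reseed_time_le[OF q H k mdpsD(3)[OF M], of u lms w r st]
      embed_iter_time_le[OF emb M k(1) lm[rule_format, of r], of Reward "fst st"] by linarith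
  then show "snd (reseed H M k k' u lms w r st) \<le> c * (real (state_count M) * real k ^ e) + 2 * (real (state_count M) * q k k' (state_count M))
        + real (state_count M) * real u" .
  show "snd (pipeline_round H M k k' u E lms w r (fst (pipeline H M k k' u E lms w r)))
        \<le> c * (real (state_count M) * real k ^ e) + 2 * (real (state_count M) * q k k' (state_count M))
        + real (state_count M) * real u
          + 2 * real E * (real R * (real (state_count M) * (real k' + real u)) * backup_cost H A m)"
    if w: "\<And>r s i. r < R \<Longrightarrow> s < state_count M \<Longrightarrow> i < u \<Longrightarrow> w (r, s, i) < state_count M" and r: "r < R"
    by (rule order_trans[OF pipeline_round_time_le[OF q H k M _ r refl] add_right_mono[OF seed]])
      (rule w)
qed

lemma pipeline_time:
  assumes H: "routine_costs H" and q: "ann_index H q"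
  shows "\<exists>c>0. \<exists>e. \<forall>m k k' u E R lms. \<forall>M\<in>mdps A m.
       1 \<le> k \<and> 1 \<le> k' \<and> 1 \<le> u \<and> 1 \<le> E \<and> 2 \<le> state_count M \<and> (\<forall>r. landmarks H M k (lms r)) \<longrightarrow>
       (AE w in measure_pmf (partners M u R).
          let n = state_count M in
          snd (pipeline H M k k' u E lms w R)
            \<le> c * (real R * (real n * (real k ^ e + q k k' n))
                 + real R ^ 2 * (real n * (real k' + real u) * real E * backup_cost H A m)))"
proof -
  obtain c e where c: "c > 0" and emb: "embed_bound H A c e"
    using embed_bound_exists[OF H] by blast
  have "snd (pipeline H M k k' u E lms w R)
      \<le> (c + 3) * (real R * (real (state_count M) * (real k ^ e + q k k' (state_count M)))
          + real R ^ 2 * (real (state_count M) * (real k' + real u) * real E * backup_cost H A m))"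
    if M: "M \<in> mdps A m" and k: "1 \<le> k" "1 \<le> k'" and E: "1 \<le> E" and lm: "\<forall>r. landmarks H M k (lms r)"
      and w: "\<And>r s i. r < R \<Longrightarrow> s < state_count M \<Longrightarrow> i < u \<Longrightarrow> w (r, s, i) < state_count M"
    for m k k' u E R lms w M
  proof -
    define n Q where "n = real (state_count M)" and "Q = q k k' (state_count M)"
    define X where "X = n * (real k' + real u) * real E * backup_cost H A m"
    have bc: "1 \<le> backup_cost H A m" by (rule backup_cost_ge_1[OF H])
    have Q: "0 \<le> Q" unfolding Q_def by (rule query_time_nonneg[OF q k mdpsD(3)[OF M]])
    have n: "0 \<le> n" by (simp add: n_def)
    have "1 * 1 \<le> real E * backup_cost H A m" using E bc by (intro mult_mono) auto
    then have "n * (real k' + real u) * 1 \<le> n * (real k' + real u) * (real E * backup_cost H A m)"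
      using n by (intro mult_left_mono) auto
    then have "n * (real k' + real u) \<le> X" by (simp add: X_def mult.assoc)
    moreover have "n * real u \<le> n * (real k' + real u)" "0 \<le> n * real u"
      using n by (auto intro: mult_left_mono)
    ultimately have uX: "n * real u \<le> X" and X: "0 \<le> X" by linarith+
    have "snd (pipeline H M k k' u E lms w R)
        \<le> real (card {..<R}) * (c * (n * real k ^ e) + 2 * (n * Q) + n * real u
          + 2 * real E * (real R * (n * (real k' + real u)) * backup_cost H A m))"
      unfolding pipeline_time_decomp n_def Q_def
      by (rule sum_bounded_above)
        (use pipeline_round_time_bound[where w = w and u = u and R = R and E = E, OF H q emb M k lm w] in auto)
    also have "\<dots> = real R * (c * (n * real k ^ e) + 2 * (n * Q)) + real R * (n * real u) + 2 * (real R ^ 2 * X)"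
      unfolding X_def by (simp add: power2_eq_square algebra_simps)
    \<comment> \<open>Exploration costs at most \<open>X\<close> per round, and R \<le> R^2 for
      natural numbers, so it joins the sweep term: one copy for exploration and two for the arms
      give the added 3.\<close>
    also have "\<dots> \<le> real R * ((c + 3) * (n * real k ^ e) + (c + 3) * (n * Q)) + real R ^ 2 * X
        + 2 * (real R ^ 2 * X)"
    proof (intro add_mono mult_left_mono mult_right_mono)
      have "real R * (n * real u) \<le> real R * X" using uX by (intro mult_left_mono) auto
      also have "\<dots> \<le> real R ^ 2 * X" using X by (intro mult_right_mono) (cases R, auto simp: power2_eq_square)
      finally show "real R * (n * real u) \<le> real R ^ 2 * X" .
    qed (use c Q n in auto)
    also have "\<dots> \<le> real R * ((c + 3) * (n * real k ^ e) + (c + 3) * (n * Q)) + (c + 3) * (real R ^ 2 * X)"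
      using c X by (simp add: algebra_simps)
    also have "\<dots> = (c + 3) * (real R * (n * (real k ^ e + Q)) + real R ^ 2 * X)"
      by (simp add: algebra_simps)
    finally show ?thesis unfolding n_def Q_def X_def .
  qed
  note bound = this
  show ?thesis
    unfolding Let_def
  proof (intro exI[of _ "c + 3"] conjI exI[of _ e] allI ballI impI)
    show "c + 3 > 0" using c by simp
  next
    fix m k k' u E R :: nat and lms :: "nat \<Rightarrow> nat list" and M
    assume M: "M \<in> mdps A m" and h: "1 \<le> k \<and> 1 \<le> k' \<and> 1 \<le> u \<and> 1 \<le> E \<and> 2 \<le> state_count M \<and>
      (\<forall>r. landmarks H M k (lms r))"
    show "AE w in measure_pmf (partners M u R). snd (pipeline H M k k' u E lms w R)
      \<le> (c + 3) * (real R * (real (state_count M) * (real k ^ e + q k k' (state_count M)))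
          + real R ^ 2 * (real (state_count M) * (real k' + real u) * real E * backup_cost H A m))"
      using h by (intro AE_partners bound[OF M]) auto
  qed
qed

text \<open>One \<open>g\<close> has to serve three claims of different strength, so it is the sum
  of \<open>G1\<close>, for the round-by-round claims, and \<open>G2\<close>, for the whole
  run.\<close>

lemma pipeline_subquadratic:
  assumes H: "routine_costs H" and q: "ann_index H q"
    and k: "1 \<le> k" "1 \<le> k'" and R: "(\<lambda>n. real (R n)) \<in> o(\<lambda>n. real n / q k k' n)"
  shows "\<exists>g :: nat \<Rightarrow> real. g \<in> o(\<lambda>n. real n ^ 2) \<and>
         (\<forall>lms. \<forall>M\<in>mdps A m. 2 \<le> state_count M \<and> (\<forall>r. landmarks H M k (lms r)) \<longrightarrow>
           (AE w in measure_pmf (partners M u (R (state_count M))).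
             let n = state_count M;
                 st = (\<lambda>r. fst (pipeline H M k k' u E lms w r));
                 seed = (\<lambda>r. reseed H M k k' u lms w r (st r)) in
             (\<Sum>r<R n. snd (seed r)
                + 2 * real E * (real (card (fst (seed r))) * backup_cost H A m)) \<le> g n \<and>
             (\<forall>r<R n. snd (pipeline_round H M k k' u E lms w r (st r)) \<le> g n) \<and>
             ((\<lambda>n. real (R n)) \<in> o(\<lambda>n. sqrt (real n)) \<longrightarrow>
                snd (pipeline H M k k' u E lms w (R n)) \<le> g n)))"
proof -
  obtain c e where c: "c > 0" and emb: "embed_bound H A c e"
    using embed_bound_exists[OF H] by blast
  define S where "S n = c * (real n * real k ^ e) + 2 * (real n * q k k' n) + real n * real u" for n
  define V where "V = 2 * real E * ((real k' + real u) * backup_cost H A m)"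
  define G1 where "G1 n = real (R n) * (S n + real n * V)" for n
  \<comment> \<open>\<open>g\<close> is fixed before the growth condition on the whole run is
    assumed, so that condition is built into \<open>G2\<close>, which is zero when it fails.\<close>
  define G2 where "G2 n = (if (\<lambda>n. real (R n)) \<in> o(\<lambda>n. sqrt (real n))
    then real (R n) * (S n + real (R n) * (real n * V)) else 0)" for n
  have bc: "1 \<le> backup_cost H A m" by (rule backup_cost_ge_1[OF H])
  have V: "0 \<le> V" using bc by (simp add: V_def)
  have q1: "1 \<le> q k k' n" if "2 \<le> n" for n
    using query_time_ge[OF q k, of n] that k by (simp add: min_def split: if_splits)
  have S0: "0 \<le> S n" if "2 \<le> n" for n
    using q1[OF that] c by (simp add: S_def)
  \<comment> \<open>Since \<open>q\<close> is at least 1 from n = 2 on, the hypothesis on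
    \<open>R\<close> also gives R = o(n), which handles the terms without \<open>q\<close>.\<close>
  have "(\<lambda>n. real n / q k k' n) \<in> O(\<lambda>n. real n)"
  proof (rule landau_o.big_mono, rule eventually_mono[OF eventually_ge_at_top[of 2]])
    fix n :: nat assume "2 \<le> n"
    then show "norm (real n / q k k' n) \<le> norm (real n)"
      using q1[of n] by (simp add: divide_le_eq mult_le_cancel_left1)
  qed
  with R have Rn: "(\<lambda>n. real (R n)) \<in> o(\<lambda>n. real n)" by (rule landau_o.small_big_trans)
  have "(\<lambda>n. q k k' n * real (R n)) \<in> o(\<lambda>n. q k k' n * (real n / q k k' n))"
    using R by (rule landau_o.small.mult_left)
  also have "(\<lambda>n. q k k' n * (real n / q k k' n)) \<in> O(\<lambda>n. real n)"
  proof (rule landau_o.big_mono, rule eventually_mono[OF eventually_ge_at_top[of 2]])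
    fix n :: nat assume "2 \<le> n"
    then show "norm (q k k' n * (real n / q k k' n)) \<le> norm (real n)"
      using q1[of n] by simp
  qed
  finally have Rq: "(\<lambda>n. q k k' n * real (R n)) \<in> o(\<lambda>n. real n)" .
  have nRn: "(\<lambda>n. real n * real (R n)) \<in> o(\<lambda>n. real n * real n)"
    and nRq: "(\<lambda>n. real n * (q k k' n * real (R n))) \<in> o(\<lambda>n. real n * real n)"
    using Rn Rq by (auto intro: landau_o.small.mult_left)
  have "(\<lambda>n. (c * real k ^ e + real u + V) * (real n * real (R n)) + 2 * (real n * (q k k' n * real (R n))))
    \<in> o(\<lambda>n. real n * real n)"
    by (intro sum_in_smallo smallo_cmult nRn nRq)
  then have G1: "G1 \<in> o(\<lambda>n. real n ^ 2)"
    unfolding G1_def[abs_def] S_def by (simp add: power2_eq_square algebra_simps)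
  have G2: "G2 \<in> o(\<lambda>n. real n ^ 2)"
  proof (cases "(\<lambda>n. real (R n)) \<in> o(\<lambda>n. sqrt (real n))")
    case True
    have "(\<lambda>n. real (R n) * real (R n)) \<in> o(\<lambda>n. sqrt (real n) * sqrt (real n))"
      using landau_o.small_mult[OF True True] .
    then have "(\<lambda>n. real n * (real (R n) * real (R n))) \<in> o(\<lambda>n. real n * real n)"
      by (intro landau_o.small.mult_left) simp
    then have "(\<lambda>n. (c * real k ^ e + real u) * (real n * real (R n))
        + 2 * (real n * (q k k' n * real (R n))) + V * (real n * (real (R n) * real (R n))))
      \<in> o(\<lambda>n. real n * real n)"
      by (intro sum_in_smallo smallo_cmult nRn nRq)
    with True show ?thesis
      unfolding G2_def[abs_def] S_def by (simp add: power2_eq_square algebra_simps)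
  next
    case False
    then show ?thesis by (simp add: G2_def[abs_def])
  qed
  define g where "g n = G1 n + G2 n" for n
  have G0: "0 \<le> G1 n" "0 \<le> G2 n" if "2 \<le> n" for n
    using S0[OF that] V by (auto simp: G1_def G2_def)
  have bound:
    "(\<Sum>r<R n. snd (reseed H M k k' u lms w r (fst (pipeline H M k k' u E lms w r)))
        + 2 * real E * (real (card (fst (reseed H M k k' u lms w r (fst (pipeline H M k k' u E lms w r)))))
          * backup_cost H A m)) \<le> g n \<and>
     (\<forall>r<R n. snd (pipeline_round H M k k' u E lms w r (fst (pipeline H M k k' u E lms w r))) \<le> g n) \<and>
     ((\<lambda>n. real (R n)) \<in> o(\<lambda>n. sqrt (real n)) \<longrightarrow> snd (pipeline H M k k' u E lms w (R n)) \<le> g n)"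
    if M: "M \<in> mdps A m" and n: "2 \<le> n" "n = state_count M" and lm: "\<forall>r. landmarks H M k (lms r)"
      and w: "\<And>r s i. r < R n \<Longrightarrow> s < state_count M \<Longrightarrow> i < u \<Longrightarrow> w (r, s, i) < state_count M"
    for M lms w n
  proof (intro conjI allI impI)
    let ?D = "\<lambda>r. reseed H M k k' u lms w r (fst (pipeline H M k k' u E lms w r))"
    have round': "snd (pipeline_round H M k k' u E lms w r (fst (pipeline H M k k' u E lms w r)))
        \<le> S n + real (R n) * (real n * V)" if r: "r < R n" for r
      using pipeline_round_time_bound[where R = "R n" and w = w and u = u and E = E, OF H q emb M k lm w r]
      by (simp add: V_def S_def n(2) algebra_simps)
    have seed': "snd (?D r) \<le> S n" for r
      using reseed_time_bound[OF H q emb M k lm] by (simp add: S_def n(2))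
    have "real (card (fst (?D r))) \<le> real n * (real k' + real u)" for r
      using card_reseed_le[OF q H k mdpsD(3)[OF M]] unfolding n(2)
      by (metis of_nat_add of_nat_le_iff of_nat_mult)
    then have "2 * real E * (real (card (fst (?D r))) * backup_cost H A m)
      \<le> 2 * real E * (real n * (real k' + real u) * backup_cost H A m)" for r
      using bc by (intro mult_left_mono mult_right_mono) auto
    also have "2 * real E * (real n * (real k' + real u) * backup_cost H A m) = real n * V"
      by (simp add: V_def)
    finally have card': "2 * real E * (real (card (fst (?D r))) * backup_cost H A m) \<le> real n * V" for r .
    have "(\<Sum>r<R n. snd (?D r) + 2 * real E * (real (card (fst (?D r))) * backup_cost H A m))
      \<le> real (card {..<R n}) * (S n + real n * V)"
      by (rule sum_bounded_above) (rule add_mono[OF seed' card'])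
    also have "\<dots> = G1 n" by (simp add: G1_def)
    finally show "(\<Sum>r<R n. snd (reseed H M k k' u lms w r (fst (pipeline H M k k' u E lms w r)))
        + 2 * real E * (real (card (fst (reseed H M k k' u lms w r (fst (pipeline H M k k' u E lms w r)))))
          * backup_cost H A m)) \<le> g n"
      using G0[OF n(1)] by (simp add: g_def)
    show "snd (pipeline_round H M k k' u E lms w r (fst (pipeline H M k k' u E lms w r))) \<le> g n"
      if r: "r < R n" for r
    proof -
      \<comment> \<open>An index r < R n shows that R n is at least 1; with it the bound for one
        round, sweeps on the full cover included, is at most \<open>G1\<close>.\<close>
      have "1 * S n \<le> real (R n) * S n" using r S0[OF n(1)] by (intro mult_right_mono) auto
      then have "S n + real (R n) * (real n * V) \<le> G1 n" by (simp add: G1_def algebra_simps)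
      with round'[OF r] G0[OF n(1)] show ?thesis by (simp add: g_def)
    qed
    assume *: "(\<lambda>n. real (R n)) \<in> o(\<lambda>n. sqrt (real n))"
    have "snd (pipeline H M k k' u E lms w (R n))
        \<le> real (card {..<R n}) * (S n + real (R n) * (real n * V))"
      unfolding pipeline_time_decomp by (rule sum_bounded_above) (use round' in auto)
    also have "\<dots> = G2 n" using * by (simp add: G2_def)
    finally show "snd (pipeline H M k k' u E lms w (R n)) \<le> g n"
      using G0[OF n(1)] by (simp add: g_def)
  qed
  have "g \<in> o(\<lambda>n. real n ^ 2)" unfolding g_def[abs_def] by (rule sum_in_smallo[OF G1 G2])
  moreover have "AE w in measure_pmf (partners M u (R (state_count M))).
    (\<Sum>r<R (state_count M). snd (reseed H M k k' u lms w r (fst (pipeline H M k k' u E lms w r)))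
        + 2 * real E * (real (card (fst (reseed H M k k' u lms w r (fst (pipeline H M k k' u E lms w r)))))
          * backup_cost H A m)) \<le> g (state_count M) \<and>
     (\<forall>r<R (state_count M).
        snd (pipeline_round H M k k' u E lms w r (fst (pipeline H M k k' u E lms w r))) \<le> g (state_count M)) \<and>
     ((\<lambda>n. real (R n)) \<in> o(\<lambda>n. sqrt (real n)) \<longrightarrow>
        snd (pipeline H M k k' u E lms w (R (state_count M))) \<le> g (state_count M))"
    if M: "M \<in> mdps A m" and n: "2 \<le> state_count M" and lm: "\<forall>r. landmarks H M k (lms r)" for M lms
    by (rule AE_partners[OF n], rule bound[OF M n refl lm])
  ultimately show ?thesis
    unfolding Let_def by (intro exI[of _ g] conjI allI ballI impI) simp_all
qed

section \<open>Closing the certificate\<close>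

text \<open>The cover only grows, so a pair outside the final cover was outside it in every round,
  and sweeps write only at covered keys. Both arms therefore still show their initial values
  there.\<close>

lemma pipeline_tables_uncovered:
  assumes "p \<notin> snd (snd (fst (pipeline H M k k' u E lms w R)))"
  shows "fst (fst (pipeline H M k k' u E lms w R)) p = None"
    and "fst (snd (fst (pipeline H M k k' u E lms w R))) p = None"
proof -
  have "fst (fst (pipeline H M k k' u E lms w R)) p = None \<and>
      fst (snd (fst (pipeline H M k k' u E lms w R))) p = None"
    using assms
  proof (induction R)
    case (Suc R)
    then have "p \<notin> snd (snd (fst (pipeline H M k k' u E lms w R)))
        \<union> fst (reseed H M k k' u lms w R (fst (pipeline H M k k' u E lms w R)))"
      unfolding pipeline_cover_Suc by simp
    moreover from this have "fst (fst (pipeline H M k k' u E lms w R)) p = None"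
        "fst (snd (fst (pipeline H M k k' u E lms w R))) p = None"
      using Suc.IH by simp_all
    ultimately show ?case
      by (simp add: bind_timed_def pipeline_round_def sweeps_uncovered)
  qed simp
  then show "fst (fst (pipeline H M k k' u E lms w R)) p = None"
    "fst (snd (fst (pipeline H M k k' u E lms w R))) p = None" by auto
qed

lemma cert_width_uncovered:
  assumes "s \<noteq> s'" and "{s, s'} \<notin> snd (snd (fst (pipeline H M k k' u E lms w R)))"
  shows "cert_width M (fst (pipeline H M k k' u E lms w R)) s s' = D_max M - reward_dist M s s'"
  using assms pipeline_tables_uncovered[OF assms(2)]
  by (simp add: cert_width_def iter_fun_def read_iter_def init_fun_def)

text \<open>For each action both rewards lie in the upper half or both in the lower half of [0, L],
  so they differ by at most L/2, which is below L because L is positive.\<close>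

lemma reward_dist_less:
  assumes wf: "mdp_wf M" and "0 < rmax M" and s: "s < state_count M" "s' < state_count M"
    and same: "{a. a < action_count M \<and> rmax M / 2 \<le> rew M s a} = {a. a < action_count M \<and> rmax M / 2 \<le> rew M s' a}"
  shows "reward_dist M s s' < rmax M"
proof -
  have "\<bar>rew M s a - rew M s' a\<bar> < rmax M" if a: "a < action_count M" for a
  proof -
    have "0 \<le> rew M s a" "rew M s a \<le> rmax M" "0 \<le> rew M s' a" "rew M s' a \<le> rmax M"
      using wf s a by (auto simp: mdp_wf_def)
    moreover have "rmax M / 2 \<le> rew M s a \<longleftrightarrow> rmax M / 2 \<le> rew M s' a"
      using same a by blast
    ultimately show ?thesis using \<open>0 < rmax M\<close> by (simp add: abs_if) linarith
  qed
  moreover have "0 < action_count M" using wf by (simp add: mdp_wf_def)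
  ultimately show ?thesis unfolding reward_dist_def by (subst Max_less_iff) auto
qed

text \<open>Turns d_R < L into a width D - d_R strictly above gamma D. Strictness also settles
  \<open>\<eta> = 0\<close> when gamma is 0, where no nonnegative \<open>\<eta>\<close> meets the
  other alternative.\<close>

lemma rmax_eq_D_max:
  assumes "mdp_wf M"
  shows "rmax M = D_max M - disc M * D_max M"
proof -
  have "D_max M * (1 - disc M) = rmax M" using assms by (simp add: D_max_def mdp_wf_def)
  then show ?thesis by (simp add: algebra_simps)
qed

text \<open>Cauchy-Schwarz over the fibres of \<open>f\<close>: few classes force many pairs inside the classes.\<close>

lemma same_class_pairs_le:
  fixes f :: "nat \<Rightarrow> 'b"
  assumes T: "finite T" "f ` {..<n} \<subseteq> T" and "finite C"
    and C: "\<And>s s'. s < n \<Longrightarrow> s' < n \<Longrightarrow> s \<noteq> s' \<Longrightarrow> f s = f s' \<Longrightarrow> {s, s'} \<in> C"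
  shows "n ^ 2 \<le> card T * (n + 2 * card C)"
proof -
  define F where "F t = {s. s < n \<and> f s = t}" for t
  define S where "S = {(s, s'). s < n \<and> s' < n \<and> f s = f s'}"
  have finF: "finite (F t)" for t by (simp add: F_def)
  have finS: "finite S"
    by (rule finite_subset[of _ "{..<n} \<times> {..<n}"]) (auto simp: S_def)
  have "(\<Union>t\<in>T. F t) = {..<n}" using T(2) by (auto simp: F_def)
  moreover have "card (\<Union>t\<in>T. F t) = (\<Sum>t\<in>T. card (F t))"
    using T(1) finF by (intro card_UN_disjoint) (auto simp: F_def)
  ultimately have n: "n = (\<Sum>t\<in>T. card (F t))" by simp
  have "(\<Union>t\<in>T. F t \<times> F t) = S" using T(2) by (auto simp: F_def S_def)
  moreover have "card (\<Union>t\<in>T. F t \<times> F t) = (\<Sum>t\<in>T. card (F t \<times> F t))"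
    using T(1) finF by (intro card_UN_disjoint) (auto simp: F_def)
  ultimately have S: "card S = (\<Sum>t\<in>T. card (F t) ^ 2)"
    by (simp add: card_cartesian_product power2_eq_square)
  have "(\<Sum>t\<in>T. real (card (F t)))\<^sup>2 \<le> (\<Sum>t\<in>T. (real (card (F t)))\<^sup>2) * real (card T)"
    using sum_squared_le_sum_of_squares[of "\<lambda>t. real (card (F t))" T] by simp
  moreover have "(\<Sum>t\<in>T. real (card (F t))) = real n"
    using n by (metis of_nat_sum)
  moreover have "(\<Sum>t\<in>T. (real (card (F t)))\<^sup>2) = real (card S)"
    unfolding S by simp
  ultimately have "real (n ^ 2) \<le> real (card S * card T)" by simp
  then have nS: "n ^ 2 \<le> card T * card S" by (simp only: of_nat_le_iff mult.commute)
  \<comment> \<open>An ordered pair is recovered from its unordered pair and one bit for the order;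
    diagonal pairs, which need not be covered, are sent to their state. This yields the bound n + 2
    card C.\<close>
  let ?h = "\<lambda>(s, s'). if s = s' then Inl s else Inr ({s, s'}, s < s')"
  have inj: "inj_on ?h S" by (auto simp: inj_on_def doubleton_eq_iff split: if_splits)
  have "?h ` S \<subseteq> {..<n} <+> (C \<times> UNIV)"
    using C by (auto simp: S_def)
  then have "card (?h ` S) \<le> card ({..<n} <+> (C \<times> (UNIV :: bool set)))"
    using \<open>finite C\<close> by (intro card_mono finite_Plus finite_cartesian_product) auto
  then have "card S \<le> n + 2 * card C"
    using \<open>finite C\<close> by (simp add: card_image[OF inj] card_Plus card_cartesian_product)
  then have "card T * card S \<le> card T * (n + 2 * card C)" by simp
  with nS show ?thesis by linarith
qed

text \<open>The classes record in which actions the reward is at least \<open>L / 2\<close>.  Inside a class the reward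
  distance stays below \<open>L\<close>, so an uncovered pair of a class keeps a width above \<open>\<eta>\<close>.\<close>

lemma closed_certificate_cover:
  assumes M: "M \<in> mdps A m" and L: "0 < rmax M" and \<eta>: "\<eta> = 0 \<or> \<eta> < disc M * D_max M"
    and closed: "\<And>s s'. s < state_count M \<Longrightarrow> s' < state_count M \<Longrightarrow>
      cert_width M (fst (pipeline H M k k' u E lms w R)) s s' \<le> \<eta>"
    and n: "2 ^ (A + 1) \<le> state_count M"
    and fin: "finite (snd (snd (fst (pipeline H M k k' u E lms w R))))"
  shows "real (state_count M) ^ 2 / 2 ^ (A + 2) \<le> real (card (snd (snd (fst (pipeline H M k k' u E lms w R)))))"
proof -
  let ?n = "state_count M" and ?C = "snd (snd (fst (pipeline H M k k' u E lms w R)))"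
  note wf = mdpsD(1)[OF M] and A = mdpsD(2)[OF M]
  define f where "f s = {a. a < A \<and> rmax M / 2 \<le> rew M s a}" for s
  have \<gamma>D: "0 \<le> disc M * D_max M"
    using wf L by (simp add: D_max_def mdp_wf_def)
  have "{s, s'} \<in> ?C" if s: "s < ?n" "s' < ?n" "s \<noteq> s'" and same: "f s = f s'" for s s'
  proof (rule ccontr)
    assume "{s, s'} \<notin> ?C"
    then have "D_max M - reward_dist M s s' \<le> \<eta>"
      using closed[OF s(1,2)] cert_width_uncovered[OF s(3)] by simp
    moreover have "reward_dist M s s' < rmax M"
      using same by (intro reward_dist_less[OF wf L s(1,2)]) (simp add: f_def A)
    ultimately show False using rmax_eq_D_max[OF wf] \<eta> \<gamma>D by linarith
  qed
  then have "?n ^ 2 \<le> card (Pow {..<A}) * (?n + 2 * card ?C)"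
    using fin by (intro same_class_pairs_le[where f = f]) (auto simp: f_def)
  then have le: "?n ^ 2 \<le> 2 ^ A * (?n + 2 * card ?C)" by (simp add: card_Pow)
  \<comment> \<open>The lower bound on n makes the diagonal contribution at most half of n^2; the
    other half must come from covered pairs, which doubles the constant to 2^(A + 2).\<close>
  have "2 ^ (A + 1) * ?n \<le> ?n * ?n" using n by (rule mult_right_mono) simp
  then have "2 * (2 ^ A * ?n) \<le> ?n ^ 2"
    by (simp only: power_add power_one_right power2_eq_square mult_ac)
  moreover have "?n ^ 2 \<le> 2 ^ A * ?n + 2 * (2 ^ A * card ?C)"
    using le by (simp only: distrib_left mult_ac)
  ultimately have "?n ^ 2 \<le> 4 * (2 ^ A * card ?C)" by linarith
  then have "?n ^ 2 \<le> 2 ^ (A + 2) * card ?C" by (simp add: power_add)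
  then have "real (?n ^ 2) \<le> real (2 ^ (A + 2) * card ?C)" by (rule of_nat_mono)
  then show ?thesis by (simp add: field_simps)
qed

text \<open>The quadratic cover is used twice: divided by the growth per round it bounds
  \<open>R\<close> from below, and as a list of pairs that had to be written down it bounds the
  time.\<close>

lemma closed_certificate_work:
  assumes H: "routine_costs H" and q: "ann_index H q"
  shows "\<exists>c>0. \<exists>n0\<ge>2. \<forall>m k k' E R lms \<eta>. \<forall>M\<in>mdps A m.
       1 \<le> k \<and> 1 \<le> k' \<and> n0 \<le> state_count M \<and> 0 < rmax M \<and> (\<eta> = 0 \<or> \<eta> < disc M * D_max M) \<longrightarrow>
       (AE w in measure_pmf (partners M u R).
          let n = state_count M; run = pipeline H M k k' u E lms w R in
          (\<forall>s<n. \<forall>s'<n. cert_width M (fst run) s s' \<le> \<eta>) \<longrightarrow>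
          c * (real n / real k') \<le> real R \<and> c * real n ^ 2 \<le> snd run)"
proof -
  \<comment> \<open>The power of 2 is that of \<open>closed_certificate_cover\<close>; 1 + u comes
    from k' + u \<le> k' (1 + u), valid for k' \<ge> 1, which isolates the dependence on k'.\<close>
  define c where "c = 1 / (2 ^ (A + 2) * (1 + real u))"
  have c0: "0 < c" by (simp add: c_def add_pos_nonneg)
  have "c * (real (state_count M) / real k') \<le> real R \<and>
      c * real (state_count M) ^ 2 \<le> snd (pipeline H M k k' u E lms w R)"
    if M: "M \<in> mdps A m" and k: "1 \<le> k" "1 \<le> k'" and n: "2 ^ (A + 1) \<le> state_count M" and L: "0 < rmax M"
      and \<eta>: "\<eta> = 0 \<or> \<eta> < disc M * D_max M"
      and w: "\<And>r s i. r < R \<Longrightarrow> s < state_count M \<Longrightarrow> i < u \<Longrightarrow> w (r, s, i) < state_count M"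
      and closed: "\<forall>s<state_count M. \<forall>s'<state_count M.
        cert_width M (fst (pipeline H M k k' u E lms w R)) s s' \<le> \<eta>"
    for m k k' E R lms \<eta> M w
  proof
    let ?n = "state_count M" and ?C = "snd (snd (fst (pipeline H M k k' u E lms w R)))"
    note a = q H k mdpsD(3)[OF M]
    have "finite ?C" by (rule covers_states_finite[OF covers_states_pipeline[OF a, where w = w]]) (rule w)
    then have big: "real ?n ^ 2 / 2 ^ (A + 2) \<le> real (card ?C)"
      using closed by (intro closed_certificate_cover[OF M L \<eta> _ n]) auto
    have n0: "0 < real ?n" using mdpsD(3)[OF M] by simp
    have "real k' + real u \<le> real k' * (1 + real u)"
      using k(2) by (simp add: distrib_left mult_le_cancel_right1)
    then have "real R * (real ?n * (real k' + real u)) \<le> real R * (real ?n * (real k' * (1 + real u)))"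
      by (intro mult_left_mono) auto
    moreover have "real (card ?C) \<le> real R * (real ?n * (real k' + real u))"
      using card_pipeline_cover_le[OF a] by (metis of_nat_add of_nat_le_iff of_nat_mult)
    ultimately have "real ?n * (real ?n / 2 ^ (A + 2)) \<le> real ?n * (real R * (real k' * (1 + real u)))"
      using big by (simp add: power2_eq_square algebra_simps)
    then have "real ?n / 2 ^ (A + 2) \<le> real R * (real k' * (1 + real u))"
      using n0 by (rule mult_left_le_imp_le)
    then have "real ?n / 2 ^ (A + 2) / (real k' * (1 + real u)) \<le> real R"
      using k(2) by (subst pos_divide_le_eq) (auto intro: add_pos_nonneg)
    then show "c * (real ?n / real k') \<le> real R"
      by (simp add: c_def mult_ac)
    have "c * real ?n ^ 2 \<le> 1 / 2 ^ (A + 2) * real ?n ^ 2"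
      unfolding c_def by (intro mult_right_mono divide_left_mono) auto
    also have "\<dots> \<le> real (card ?C)" using big by simp
    also have "\<dots> \<le> snd (pipeline H M k k' u E lms w R)"
      by (rule card_pipeline_cover_le_time[OF a])
    finally show "c * real ?n ^ 2 \<le> snd (pipeline H M k k' u E lms w R)" .
  qed
  note bound = this
  show ?thesis
    unfolding Let_def
  proof (intro exI[of _ c] conjI exI[of _ "2 ^ (A + 1)"] allI ballI impI)
    show "0 < c" "(2::nat) \<le> 2 ^ (A + 1)" using c0 by simp_all
  next
    fix m k k' E R :: nat and lms :: "nat \<Rightarrow> nat list" and \<eta> M
    assume M: "M \<in> mdps A m" and h: "1 \<le> k \<and> 1 \<le> k' \<and> 2 ^ (A + 1) \<le> state_count M \<and> 0 < rmax M \<and>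
      (\<eta> = 0 \<or> \<eta> < disc M * D_max M)"
    have "(2::nat) * 1 \<le> 2 * 2 ^ A" by (intro mult_left_mono) auto
    then have n: "2 \<le> state_count M" using h by (simp only: power_add power_one_right) linarith
    show "AE w in measure_pmf (partners M u R).
      (\<forall>s<state_count M. \<forall>s'<state_count M.
        cert_width M (fst (pipeline H M k k' u E lms w R)) s s' \<le> \<eta>) \<longrightarrow>
      c * (real (state_count M) / real k') \<le> real R \<and>
      c * real (state_count M) ^ 2 \<le> snd (pipeline H M k k' u E lms w R)"
      by (rule AE_partners[OF n], rule impI, rule bound[OF M]) (use h in auto)
  qed
qed

theorem theorem1:
  fixes H :: routines and q :: "nat \<Rightarrow> nat \<Rightarrow> nat \<Rightarrow> real" and A :: nat
  assumes "0 < A" and "routine_costs H" and "ann_index H q"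
  shows "
    \<comment> \<open>cost of one covered backup\<close>
    ((\<lambda>m. backup_cost H A m) \<in> O(\<lambda>m. real m ^ 3 * ln (real m)) \<and>
     (\<forall>m. \<forall>M\<in>mdps A m. \<forall>ini t s s'. s < state_count M \<and> s' < state_count M \<longrightarrow>
        snd (backup H M (read_iter M ini t) s s') \<le> backup_cost H A m)) \<and>
    \<comment> \<open>(1)\<close>
    (\<exists>c>0. \<exists>e. \<forall>m k k' z ini lm. \<forall>M\<in>mdps A m. 1 \<le> k \<and> 1 \<le> k' \<and> landmarks H M k lm \<longrightarrow>
       (let n = state_count M; C = fst (setup_cover H M ini z k k' lm) in
        snd (setup_cover H M ini z k k' lm) \<le> c * (real n * (real k ^ e + q k k' n)) \<and>
        (\<forall>t. snd (sweep H M ini C t) \<le> c * (real n * real k' * backup_cost H A m)))) \<and>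
    \<comment> \<open>(2) accuracy and total time\<close>
    (\<exists>c>0. \<exists>e. \<forall>m k k' z ini lm \<epsilon>. \<forall>M\<in>mdps A m.
       1 \<le> k \<and> 1 \<le> k' \<and> landmarks H M k lm \<and> 0 < \<epsilon> \<longrightarrow>
       (let n = state_count M; K = sweep_count M ini \<epsilon>;
            run = single_build H M ini z k k' lm K in
        real K \<le> c * (log_gap M ini \<epsilon> / (1 - disc M)) \<and>
        covered_error M (snd (fst run)) (fst (fst run))
          \<le> disc M * coverage_floor M ini (snd (fst run)) + \<epsilon> \<and>
        snd run \<le> c * (real n * (real k ^ e + q k k' n)
          + real n * real k' * backup_cost H A m / (1 - disc M) * log_gap M ini \<epsilon>))) \<and>
    \<comment> \<open>(2) locality-sensitive hashing\<close>
    (\<forall>m k k' \<rho>. 1 \<le> k \<and> 1 \<le> k' \<and> 0 \<le> \<rho> \<and> \<rho> < 1 \<and> q k k' \<in> O(\<lambda>n. real n powr \<rho>) \<longrightarrow>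
       (\<exists>c j. \<forall>z ini lm \<epsilon>. \<forall>M\<in>mdps A m. landmarks H M k lm \<and> 0 < \<epsilon> \<longrightarrow>
          (let n = state_count M in
           snd (single_build H M ini z k k' lm (sweep_count M ini \<epsilon>))
             \<le> c * (real n powr (1 + \<rho>) + real n / (1 - disc M))
                 * (max 1 (ln (real n)) ^ j * log_gap M ini \<epsilon>)))) \<and>
    \<comment> \<open>(2) polylogarithmic queries\<close>
    (\<forall>m k k' i. 1 \<le> k \<and> 1 \<le> k' \<and> q k k' \<in> O(\<lambda>n. ln (real n) ^ i) \<longrightarrow>
       (\<exists>c j. \<forall>z ini lm \<epsilon>. \<forall>M\<in>mdps A m. landmarks H M k lm \<and> 0 < \<epsilon> \<longrightarrow>
          (let n = state_count M in
           snd (single_build H M ini z k k' lm (sweep_count M ini \<epsilon>))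
             \<le> c * (real n / (1 - disc M)) * (max 1 (ln (real n)) ^ j * log_gap M ini \<epsilon>)))) \<and>
    \<comment> \<open>(2) sub-quadratic in the number of states in either case\<close>
    (\<forall>m k k'. 1 \<le> k \<and> 1 \<le> k' \<and>
       ((\<exists>\<rho><1. q k k' \<in> O(\<lambda>n. real n powr \<rho>)) \<or> (\<exists>i. q k k' \<in> O(\<lambda>n. ln (real n) ^ i))) \<longrightarrow>
       (\<exists>g :: nat \<Rightarrow> real. g \<in> o(\<lambda>n. real n ^ 2) \<and>
         (\<forall>z ini lm \<epsilon>. \<forall>M\<in>mdps A m. landmarks H M k lm \<and> 0 < \<epsilon> \<longrightarrow>
            snd (single_build H M ini z k k' lm (sweep_count M ini \<epsilon>))
              \<le> g (state_count M) * (log_gap M ini \<epsilon> / (1 - disc M))))) \<and>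
    \<comment> \<open>(2) one exact all-pairs sweep: upper bound, matching lower bound on every instance
        for fixed \<open>m\<close>, matching worst-case lower bound uniformly in \<open>m\<close>\<close>
    ((\<forall>m. \<forall>M\<in>mdps A m. \<forall>f. fst (full_sweep H M f) = bisim_op M f) \<and>
     (\<exists>c. \<forall>m. \<forall>M\<in>mdps A m. \<forall>f.
        snd (full_sweep H M f) \<le> c * (real (state_count M) ^ 2 * backup_cost H A m)) \<and>
     (\<forall>m. \<exists>c>0. \<forall>M\<in>mdps A m. \<forall>f. 2 \<le> state_count M \<longrightarrow>
        c * (real (state_count M) ^ 2 * backup_cost H A m) \<le> snd (full_sweep H M f)) \<and>
     (\<exists>c>0. \<forall>m\<ge>1. \<forall>n\<ge>2 * m. \<exists>M\<in>mdps A m. state_count M = n \<and>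
        (\<forall>f. c * (real n ^ 2 * backup_cost H A m) \<le> snd (full_sweep H M f)))) \<and>
    \<comment> \<open>(3) total time of the re-seeded pipeline\<close>
    (\<exists>c>0. \<exists>e. \<forall>m k k' u E R lms. \<forall>M\<in>mdps A m.
       1 \<le> k \<and> 1 \<le> k' \<and> 1 \<le> u \<and> 1 \<le> E \<and> 2 \<le> state_count M \<and> (\<forall>r. landmarks H M k (lms r)) \<longrightarrow>
       (AE w in measure_pmf (partners M u R).
          let n = state_count M in
          snd (pipeline H M k k' u E lms w R)
            \<le> c * (real R * (real n * (real k ^ e + q k k' n))
                 + real R ^ 2 * (real n * (real k' + real u) * real E * backup_cost H A m)))) \<and>
    \<comment> \<open>(3) sub-quadratic growth of: all re-seeding work plus, in each round, the backups of the
        pairs retrieved in it; every single round on the cumulative covered set; the whole run\<close>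
    (\<forall>m k k' u E. \<forall>R :: nat \<Rightarrow> nat. 1 \<le> k \<and> 1 \<le> k' \<and> 1 \<le> u \<and> 1 \<le> E \<and>
       (\<lambda>n. real (R n)) \<in> o(\<lambda>n. real n / q k k' n) \<longrightarrow>
       (\<exists>g :: nat \<Rightarrow> real. g \<in> o(\<lambda>n. real n ^ 2) \<and>
         (\<forall>lms. \<forall>M\<in>mdps A m. 2 \<le> state_count M \<and> (\<forall>r. landmarks H M k (lms r)) \<longrightarrow>
           (AE w in measure_pmf (partners M u (R (state_count M))).
             let n = state_count M;
                 st = (\<lambda>r. fst (pipeline H M k k' u E lms w r));
                 seed = (\<lambda>r. reseed H M k k' u lms w r (st r)) in
             (\<Sum>r<R n. snd (seed r)
                + 2 * real E * (real (card (fst (seed r))) * backup_cost H A m)) \<le> g n \<and>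
             (\<forall>r<R n. snd (pipeline_round H M k k' u E lms w r (st r)) \<le> g n) \<and>
             ((\<lambda>n. real (R n)) \<in> o(\<lambda>n. sqrt (real n)) \<longrightarrow>
                snd (pipeline H M k k' u E lms w (R n)) \<le> g n))))) \<and>
    \<comment> \<open>(3) closing the certificate on all pairs (\<eta> = 0, or even below disc M * D_max M)\<close>
    (\<forall>u\<ge>1. \<exists>c>0. \<exists>n0\<ge>2. \<forall>m k k' E R lms \<eta>. \<forall>M\<in>mdps A m.
       1 \<le> k \<and> 1 \<le> k' \<and> n0 \<le> state_count M \<and> 0 < rmax M \<and> (\<forall>r. landmarks H M k (lms r)) \<and>
       0 \<le> \<eta> \<and> (\<eta> = 0 \<or> \<eta> < disc M * D_max M) \<longrightarrow>
       (AE w in measure_pmf (partners M u R).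
          let n = state_count M; run = pipeline H M k k' u E lms w R in
          (\<forall>s<n. \<forall>s'<n. cert_width M (fst run) s s' \<le> \<eta>) \<longrightarrow>
          c * (real n / real k') \<le> real R \<and> c * real n ^ 2 \<le> snd run))"
proof (intro conjI)
  note H = \<open>routine_costs H\<close> and q = \<open>ann_index H q\<close>
  show "(\<lambda>m. backup_cost H A m) \<in> O(\<lambda>m. real m ^ 3 * ln (real m))"
    by (rule backup_cost_bigo[OF H])
  show "\<forall>m. \<forall>M\<in>mdps A m. \<forall>ini t s s'. s < state_count M \<and> s' < state_count M \<longrightarrow>
        snd (backup H M (read_iter M ini t) s s') \<le> backup_cost H A m"
    using backup_iter_time_le[OF H] by blast
  show "\<exists>c>0. \<exists>e. \<forall>m k k' z ini lm. \<forall>M\<in>mdps A m. 1 \<le> k \<and> 1 \<le> k' \<and> landmarks H M k lm \<longrightarrow>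
       (let n = state_count M; C = fst (setup_cover H M ini z k k' lm) in
        snd (setup_cover H M ini z k k' lm) \<le> c * (real n * (real k ^ e + q k k' n)) \<and>
        (\<forall>t. snd (sweep H M ini C t) \<le> c * (real n * real k' * backup_cost H A m)))"
    by (rule setup_and_sweep_time[OF H q])
  show "\<exists>c>0. \<exists>e. \<forall>m k k' z ini lm \<epsilon>. \<forall>M\<in>mdps A m.
       1 \<le> k \<and> 1 \<le> k' \<and> landmarks H M k lm \<and> 0 < \<epsilon> \<longrightarrow>
       (let n = state_count M; K = sweep_count M ini \<epsilon>;
            run = single_build H M ini z k k' lm K in
        real K \<le> c * (log_gap M ini \<epsilon> / (1 - disc M)) \<and>
        covered_error M (snd (fst run)) (fst (fst run))
          \<le> disc M * coverage_floor M ini (snd (fst run)) + \<epsilon> \<and>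
        snd run \<le> c * (real n * (real k ^ e + q k k' n)
          + real n * real k' * backup_cost H A m / (1 - disc M) * log_gap M ini \<epsilon>))"
    by (rule single_build_accuracy_and_time[OF H q])
  show "\<forall>m k k' \<rho>. 1 \<le> k \<and> 1 \<le> k' \<and> 0 \<le> \<rho> \<and> \<rho> < 1 \<and> q k k' \<in> O(\<lambda>n. real n powr \<rho>) \<longrightarrow>
       (\<exists>c j. \<forall>z ini lm \<epsilon>. \<forall>M\<in>mdps A m. landmarks H M k lm \<and> 0 < \<epsilon> \<longrightarrow>
          (let n = state_count M in
           snd (single_build H M ini z k k' lm (sweep_count M ini \<epsilon>))
             \<le> c * (real n powr (1 + \<rho>) + real n / (1 - disc M))
                 * (max 1 (ln (real n)) ^ j * log_gap M ini \<epsilon>)))"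
  proof (intro allI impI)
    fix m k k' :: nat and \<rho> :: real
    assume "1 \<le> k \<and> 1 \<le> k' \<and> 0 \<le> \<rho> \<and> \<rho> < 1 \<and> q k k' \<in> O(\<lambda>n. real n powr \<rho>)"
    then obtain c where "\<forall>z ini lm \<epsilon>. \<forall>M\<in>mdps A m. landmarks H M k lm \<longrightarrow>
      snd (single_build H M ini z k k' lm (sweep_count M ini \<epsilon>))
        \<le> c * (real (state_count M) powr (1 + \<rho>) + real (state_count M) / (1 - disc M)) * log_gap M ini \<epsilon>"
      using single_build_time_lsh[OF H q] by blast
    then show "\<exists>c j. \<forall>z ini lm \<epsilon>. \<forall>M\<in>mdps A m. landmarks H M k lm \<and> 0 < \<epsilon> \<longrightarrow>
          (let n = state_count M in
           snd (single_build H M ini z k k' lm (sweep_count M ini \<epsilon>))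
             \<le> c * (real n powr (1 + \<rho>) + real n / (1 - disc M))
                 * (max 1 (ln (real n)) ^ j * log_gap M ini \<epsilon>))"
      \<comment> \<open>The logarithmic exponent can be 0 because the amortized query time already
        includes the index build.\<close>
      by (intro exI[of _ c] exI[of _ 0]) simp
  qed
  show "\<forall>m k k' i. 1 \<le> k \<and> 1 \<le> k' \<and> q k k' \<in> O(\<lambda>n. ln (real n) ^ i) \<longrightarrow>
       (\<exists>c j. \<forall>z ini lm \<epsilon>. \<forall>M\<in>mdps A m. landmarks H M k lm \<and> 0 < \<epsilon> \<longrightarrow>
          (let n = state_count M in
           snd (single_build H M ini z k k' lm (sweep_count M ini \<epsilon>))
             \<le> c * (real n / (1 - disc M)) * (max 1 (ln (real n)) ^ j * log_gap M ini \<epsilon>)))"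
  proof (intro allI impI, elim conjE)
    fix m k k' i :: nat
    assume "1 \<le> k" "1 \<le> k'" "q k k' \<in> O(\<lambda>n. ln (real n) ^ i)"
    from single_build_time_polylog[OF H q this, of A m]
    show "\<exists>c j. \<forall>z ini lm \<epsilon>. \<forall>M\<in>mdps A m. landmarks H M k lm \<and> 0 < \<epsilon> \<longrightarrow>
          (let n = state_count M in
           snd (single_build H M ini z k k' lm (sweep_count M ini \<epsilon>))
             \<le> c * (real n / (1 - disc M)) * (max 1 (ln (real n)) ^ j * log_gap M ini \<epsilon>))"
      unfolding Let_def by blast
  qed
  show "\<forall>m k k'. 1 \<le> k \<and> 1 \<le> k' \<and>
       ((\<exists>\<rho><1. q k k' \<in> O(\<lambda>n. real n powr \<rho>)) \<or> (\<exists>i. q k k' \<in> O(\<lambda>n. ln (real n) ^ i))) \<longrightarrow>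
       (\<exists>g :: nat \<Rightarrow> real. g \<in> o(\<lambda>n. real n ^ 2) \<and>
         (\<forall>z ini lm \<epsilon>. \<forall>M\<in>mdps A m. landmarks H M k lm \<and> 0 < \<epsilon> \<longrightarrow>
            snd (single_build H M ini z k k' lm (sweep_count M ini \<epsilon>))
              \<le> g (state_count M) * (log_gap M ini \<epsilon> / (1 - disc M))))"
  proof (intro allI impI, elim conjE)
    fix m k k' :: nat
    assume "1 \<le> k" "1 \<le> k'"
      and "(\<exists>\<rho><1. q k k' \<in> O(\<lambda>n. real n powr \<rho>)) \<or> (\<exists>i. q k k' \<in> O(\<lambda>n. ln (real n) ^ i))"
    from single_build_subquadratic[OF H q this, of A m]
    show "\<exists>g :: nat \<Rightarrow> real. g \<in> o(\<lambda>n. real n ^ 2) \<and>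
         (\<forall>z ini lm \<epsilon>. \<forall>M\<in>mdps A m. landmarks H M k lm \<and> 0 < \<epsilon> \<longrightarrow>
            snd (single_build H M ini z k k' lm (sweep_count M ini \<epsilon>))
              \<le> g (state_count M) * (log_gap M ini \<epsilon> / (1 - disc M)))"
      by blast
  qed
  show "\<forall>m. \<forall>M\<in>mdps A m. \<forall>f. fst (full_sweep H M f) = bisim_op M f"
    by (simp add: fst_full_sweep)
  show "\<exists>c. \<forall>m. \<forall>M\<in>mdps A m. \<forall>f.
        snd (full_sweep H M f) \<le> c * (real (state_count M) ^ 2 * backup_cost H A m)"
    using full_sweep_time_le[OF H] by (intro exI[of _ 1]) simp
  show "\<forall>m. \<exists>c>0. \<forall>M\<in>mdps A m. \<forall>f. 2 \<le> state_count M \<longrightarrow>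
        c * (real (state_count M) ^ 2 * backup_cost H A m) \<le> snd (full_sweep H M f)"
    using full_sweep_time_ge_fixed[OF H] by blast
  show "\<exists>c>0. \<forall>m\<ge>1. \<forall>n\<ge>2 * m. \<exists>M\<in>mdps A m. state_count M = n \<and>
        (\<forall>f. c * (real n ^ 2 * backup_cost H A m) \<le> snd (full_sweep H M f))"
    by (rule full_sweep_time_ge_uniform[OF H \<open>0 < A\<close>])
  show "\<exists>c>0. \<exists>e. \<forall>m k k' u E R lms. \<forall>M\<in>mdps A m.
       1 \<le> k \<and> 1 \<le> k' \<and> 1 \<le> u \<and> 1 \<le> E \<and> 2 \<le> state_count M \<and> (\<forall>r. landmarks H M k (lms r)) \<longrightarrow>
       (AE w in measure_pmf (partners M u R).
          let n = state_count M in
          snd (pipeline H M k k' u E lms w R)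
            \<le> c * (real R * (real n * (real k ^ e + q k k' n))
                 + real R ^ 2 * (real n * (real k' + real u) * real E * backup_cost H A m)))"
    by (rule pipeline_time[OF H q])
  show "\<forall>m k k' u E. \<forall>R :: nat \<Rightarrow> nat. 1 \<le> k \<and> 1 \<le> k' \<and> 1 \<le> u \<and> 1 \<le> E \<and>
       (\<lambda>n. real (R n)) \<in> o(\<lambda>n. real n / q k k' n) \<longrightarrow>
       (\<exists>g :: nat \<Rightarrow> real. g \<in> o(\<lambda>n. real n ^ 2) \<and>
         (\<forall>lms. \<forall>M\<in>mdps A m. 2 \<le> state_count M \<and> (\<forall>r. landmarks H M k (lms r)) \<longrightarrow>
           (AE w in measure_pmf (partners M u (R (state_count M))).
             let n = state_count M;
                 st = (\<lambda>r. fst (pipeline H M k k' u E lms w r));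
                 seed = (\<lambda>r. reseed H M k k' u lms w r (st r)) in
             (\<Sum>r<R n. snd (seed r)
                + 2 * real E * (real (card (fst (seed r))) * backup_cost H A m)) \<le> g n \<and>
             (\<forall>r<R n. snd (pipeline_round H M k k' u E lms w r (st r)) \<le> g n) \<and>
             ((\<lambda>n. real (R n)) \<in> o(\<lambda>n. sqrt (real n)) \<longrightarrow>
                snd (pipeline H M k k' u E lms w (R n)) \<le> g n))))"
    by (intro allI impI, elim conjE, rule pipeline_subquadratic[OF H q])
  show "\<forall>u\<ge>1. \<exists>c>0. \<exists>n0\<ge>2. \<forall>m k k' E R lms \<eta>. \<forall>M\<in>mdps A m.
       1 \<le> k \<and> 1 \<le> k' \<and> n0 \<le> state_count M \<and> 0 < rmax M \<and> (\<forall>r. landmarks H M k (lms r)) \<and>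
       0 \<le> \<eta> \<and> (\<eta> = 0 \<or> \<eta> < disc M * D_max M) \<longrightarrow>
       (AE w in measure_pmf (partners M u R).
          let n = state_count M; run = pipeline H M k k' u E lms w R in
          (\<forall>s<n. \<forall>s'<n. cert_width M (fst run) s s' \<le> \<eta>) \<longrightarrow>
          c * (real n / real k') \<le> real R \<and> c * real n ^ 2 \<le> snd run)"
  proof (intro allI impI)
    fix u :: nat
    obtain c n0 where "0 < c" "2 \<le> n0" and work: "\<forall>m k k' E R lms \<eta>. \<forall>M\<in>mdps A m.
       1 \<le> k \<and> 1 \<le> k' \<and> n0 \<le> state_count M \<and> 0 < rmax M \<and> (\<eta> = 0 \<or> \<eta> < disc M * D_max M) \<longrightarrow>
       (AE w in measure_pmf (partners M u R).
          let n = state_count M; run = pipeline H M k k' u E lms w R in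
          (\<forall>s<n. \<forall>s'<n. cert_width M (fst run) s s' \<le> \<eta>) \<longrightarrow>
          c * (real n / real k') \<le> real R \<and> c * real n ^ 2 \<le> snd run)"
      using closed_certificate_work[OF H q, of A u] by blast
    show "\<exists>c>0. \<exists>n0\<ge>2. \<forall>m k k' E R lms \<eta>. \<forall>M\<in>mdps A m.
       1 \<le> k \<and> 1 \<le> k' \<and> n0 \<le> state_count M \<and> 0 < rmax M \<and> (\<forall>r. landmarks H M k (lms r)) \<and>
       0 \<le> \<eta> \<and> (\<eta> = 0 \<or> \<eta> < disc M * D_max M) \<longrightarrow>
       (AE w in measure_pmf (partners M u R).
          let n = state_count M; run = pipeline H M k k' u E lms w R in
          (\<forall>s<n. \<forall>s'<n. cert_width M (fst run) s s' \<le> \<eta>) \<longrightarrow>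
          c * (real n / real k') \<le> real R \<and> c * real n ^ 2 \<le> snd run)"
      using \<open>0 < c\<close> \<open>2 \<le> n0\<close> by (intro exI[of _ c] conjI exI[of _ n0] allI ballI impI work[rule_format]) simp_all
  qed
qed

end
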